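(* Let $m$ be a positive integer with $4\mid m$. (i) Every integer $N\ge 28m^3$ can be written as $p_{m+2}(x_1)+p_{m+2}(x_2)+p_{m+2}(x_3)+p_{m+2}(x_4)$ with $x_1,x_2,x_3,x_4\in\mathbb{N}$. (ii) There are infinitely many positive integers that cannot be written as $p_{m+4}(x_1)+p_{m+4}(x_2)+p_{m+4}(x_3)+p_{m+4}(x_4)$ with $x_1,x_2,x_3,x_4\in\mathbb{N}$.
   Context: $\mathbb{N}=\{0,1,2,\dots\}$. For an integer $k\ge 3$ and an integer $n$, the $k$-gonal number is $p_k(n)=(k-2)\binom{n}{2}+n=\frac{(k-2)n^2-(k-4)n}{2}$; in particular $p_{m+2}(n)=m\binom n2+n$. *)

theory Defs
  imports Complex_Main
begin

(* Meaningful for k >= 3.  The quotient is the binomial coefficient n choose 2, for negative n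
   as well; the division is exact because n * (n - 1) is even. *)
definition polygonal :: "int \<Rightarrow> int \<Rightarrow> int" where
  "polygonal k n = (k - 2) * (n * (n - 1) div 2) + n"

lemma two_polygonal: "2 * polygonal k n = (k - 2) * n\<^sup>2 - (k - 4) * n"
proof -
  have "2 * (n * (n - 1) div 2) = n * (n - 1)"
    by (rule dvd_mult_div_cancel) simp
  then have "(k - 2) * (2 * (n * (n - 1) div 2)) = (k - 2) * (n * (n - 1))"
    by (rule arg_cong)
  then show ?thesis
    unfolding polygonal_def by (simp only: algebra_simps power2_eq_square)
qed

end

theory Submission
  imports Defs "HOL-Analysis.Analysis" "HOL-Number_Theory.Number_Theory"
    "HOL-Computational_Algebra.Squarefree" "HOL-Library.Discrete_Functions"
begin

text \<open>
  (i) If \<open>a\<close> is the sum of the \<open>x\<^sub>i\<^sup>2\<close> and \<open>b\<close> the sum of the \<open>x\<^sub>i\<close>, the sum of the polygonal numbers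
  is \<open>m (a - b) / 2 + b\<close>. By Cauchy's argument suitable \<open>x\<^sub>i\<close> exist for given \<open>a\<close> and \<open>b\<close> if
  \<open>b\<^sup>2 \<le> 4 a\<close>, \<open>3 a < b\<^sup>2 + 2 b + 4\<close> and \<open>4 a - b\<^sup>2\<close> is a sum of three squares of the right parity;
  since \<open>4\<close> divides \<open>m\<close>, one can arrange that \<open>a, b\<close> are odd or that \<open>b\<close> is even and \<open>a mod 4 = 2\<close>.

  The three squares theorem for \<open>n\<close> is obtained in the manner of Ankeny from a number \<open>Q\<close> such that
  \<open>-n\<close> is a square modulo \<open>Q\<close> and \<open>-Q\<close> is a square modulo \<open>n\<close>. As \<open>Q\<close> need not be prime, Dirichlet's
  theorem is avoided: if \<open>\<phi>\<close> denotes the quadratic character belonging to \<open>-n\<close>, the sums of \<open>\<phi>\<close> over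
  the divisors of \<open>q\<close> are nonnegative, at least 1 for squares \<open>q\<close>, and nonzero only if \<open>-n\<close> is a square
  modulo the squarefree part of \<open>q\<close>. Their generating function therefore diverges as \<open>t\<close> tends to 1,
  whereas its twists by the Legendre symbols modulo the primes dividing \<open>n\<close> are Lambert series of pairs
  of nonprincipal characters, which stay bounded. Hence these Legendre symbols can be prescribed.

  (ii) Completing squares turns a representation of \<open>N\<close> into a representation of
  \<open>(m / 2 + 1) N + m\<^sup>2 / 4\<close> by squares of integers congruent to \<open>-m / 4\<close> modulo \<open>m / 2 + 1\<close>. The numbers
  \<open>2 * 4 ^ n\<close> and \<open>4 ^ n\<close> have too few representations by four squares for this.
\<close>

section \<open>Real characters\<close>

text \<open>Real Dirichlet characters modulo \<open>M\<close>, real-valued so that they can serve as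
  coefficients of power series. The last clause combines vanishing off the units with the values 1
  and -1 on them.\<close>

definition real_character :: "nat \<Rightarrow> (nat \<Rightarrow> real) \<Rightarrow> bool" where
  "real_character M \<phi> \<longleftrightarrow>
     (\<forall>a b. \<phi> (a * b) = \<phi> a * \<phi> b) \<and> (\<forall>a. \<phi> (a + M) = \<phi> a) \<and>
     (\<forall>a. \<phi> a = (if coprime a M then 1 else 0) \<or> \<phi> a = (if coprime a M then -1 else 0))"

lemma real_character_mult: "real_character M \<phi> \<Longrightarrow> \<phi> (a * b) = \<phi> a * \<phi> b"
  and real_character_periodic: "real_character M \<phi> \<Longrightarrow> \<phi> (a + M) = \<phi> a"
  and real_character_coprime: "real_character M \<phi> \<Longrightarrow> coprime a M \<Longrightarrow> \<phi> a = 1 \<or> \<phi> a = -1"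
  and real_character_not_coprime: "real_character M \<phi> \<Longrightarrow> \<not> coprime a M \<Longrightarrow> \<phi> a = 0"
  and real_character_cases: "real_character M \<phi> \<Longrightarrow> \<phi> a = 0 \<or> \<phi> a = 1 \<or> \<phi> a = -1"
  unfolding real_character_def by (meson | metis)+

lemma real_character_abs_le: "real_character M \<phi> \<Longrightarrow> \<bar>\<phi> a\<bar> \<le> 1"
  using real_character_cases[of M \<phi> a] by auto

lemma real_character_1: "real_character M \<phi> \<Longrightarrow> \<phi> 1 = 1"
  using real_character_mult[of M \<phi> 1 1] real_character_coprime[of M \<phi> 1] by auto

lemma real_character_0: "real_character M \<phi> \<Longrightarrow> M > 1 \<Longrightarrow> \<phi> 0 = 0"
  by (rule real_character_not_coprime) auto

lemma real_character_times:
  assumes "real_character M \<phi>" "real_character M \<psi>"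
  shows "real_character M (\<lambda>a. \<phi> a * \<psi> a)"
  using assms unfolding real_character_def
  by (intro conjI allI) (metis mult.left_commute mult.commute, metis, metis mult_zero_left mult_minus1_right mult_1_right minus_minus)

lemma real_character_principal: "real_character M (\<lambda>a. if coprime a M then 1 else 0)"
proof -
  have "coprime (a + M) M \<longleftrightarrow> coprime a M" for a
    by (metis coprime_iff_gcd_eq_1 gcd_add1)
  then show ?thesis unfolding real_character_def by auto
qed

text \<open>The first factor is the principal character; it makes the product over the empty set a
  character modulo \<open>M\<close> as well.\<close>

lemma real_character_prod:
  assumes "finite I" "\<And>i. i \<in> I \<Longrightarrow> real_character M (\<psi> i)"
  shows "real_character M (\<lambda>a. (if coprime a M then 1 else 0) * (\<Prod>i\<in>I. \<psi> i a))"
  using assms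
proof (induction I rule: finite_induct)
  case empty
  then show ?case using real_character_principal[of M] by simp
next
  case (insert i I)
  have "real_character M (\<lambda>a. \<psi> i a * ((if coprime a M then 1 else 0) * (\<Prod>i\<in>I. \<psi> i a)))"
    by (rule real_character_times) (use insert in simp_all)
  then show ?case using insert.hyps by (simp add: mult.left_commute)
qed

lemma periodic_add_mult:
  fixes f :: "nat \<Rightarrow> 'a"
  assumes "\<And>a. f (a + M) = f a"
  shows "f (a + M * k) = f a"
proof (induction k)
  case (Suc k)
  then show ?case using assms[of "a + M * k"] by (simp add: algebra_simps)
qed simp

lemma periodic_mod:
  fixes f :: "nat \<Rightarrow> 'a"
  assumes "\<And>a. f (a + M) = f a"
  shows "f (a mod M) = f a"
  using periodic_add_mult[where f = f and M = M and a = "a mod M" and k = "a div M"] assms by (simp add: ac_simps)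

text \<open>Multiplication by the unit \<open>a\<close> permutes the residues, so the sum over a
  period equals its own negative.\<close>

lemma real_character_sum_0:
  assumes "real_character M \<phi>" "M > 0" "\<phi> a = -1"
  shows "(\<Sum>r<M. \<phi> r) = 0"
proof -
  have cop: "coprime a M"
    using assms real_character_not_coprime by force
  have inj: "inj_on (\<lambda>r. (a * r) mod M) {..<M}"
  proof (rule inj_onI)
    fix x y assume xy: "x \<in> {..<M}" "y \<in> {..<M}" "(a * x) mod M = (a * y) mod M"
    then have "[a * x = a * y] (mod M)" by (simp add: cong_def)
    then have "[x = y] (mod M)" using cop by (simp add: cong_mult_lcancel_nat)
    then show "x = y" using xy by (simp add: cong_def)
  qed
  then have "bij_betw (\<lambda>r. (a * r) mod M) {..<M} {..<M}"
    using assms(2) by (intro bij_betw_imageI endo_inj_surj) auto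
  then have "(\<Sum>r<M. \<phi> r) = (\<Sum>r<M. \<phi> ((a * r) mod M))"
    by (rule sum.reindex_bij_betw[symmetric])
  also have "\<dots> = (\<Sum>r<M. \<phi> a * \<phi> r)"
    using periodic_mod[of \<phi> M] real_character_periodic[OF assms(1)] real_character_mult[OF assms(1)] by simp
  also have "\<dots> = - (\<Sum>r<M. \<phi> r)" using assms(3) by (simp add: sum_negf)
  finally show ?thesis by simp
qed

section \<open>Sums with periodic coefficients\<close>

text \<open>Whole periods contribute nothing and can be stripped off until less than one period is
  left.\<close>

lemma periodic_partial_sums_bounded:
  fixes f :: "nat \<Rightarrow> real"
  assumes per: "\<And>a. f (a + M) = f a" and "M > 0" and zero: "(\<Sum>r<M. f r) = 0"
  shows "\<bar>\<Sum>d<D. f d\<bar> \<le> (\<Sum>d<M. \<bar>f d\<bar>)"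
proof (induction D rule: less_induct)
  case (less D)
  show ?case
  proof (cases "D < M")
    case True
    have "\<bar>\<Sum>d<D. f d\<bar> \<le> (\<Sum>d<D. \<bar>f d\<bar>)" by (rule sum_abs)
    also have "\<dots> \<le> (\<Sum>d<M. \<bar>f d\<bar>)" using True by (intro sum_mono2) auto
    finally show ?thesis .
  next
    case False
    then have D: "D = (D - M) + M" by simp
    have "(\<Sum>d<D. f d) = (\<Sum>d<M. f d) + (\<Sum>d=M..<D. f d)"
      using False by (simp add: lessThan_atLeast0 sum.atLeastLessThan_concat)
    also have "(\<Sum>d=M..<D. f d) = (\<Sum>d<D - M. f (d + M))"
      using sum.shift_bounds_nat_ivl[of f 0 M "D - M"] False by (simp add: lessThan_atLeast0)
    finally have "(\<Sum>d<D. f d) = (\<Sum>d<D - M. f d)" by (simp add: per zero)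
    then show ?thesis using less[of "D - M"] False \<open>M > 0\<close> by simp
  qed
qed

text \<open>Summation by parts: bounded partial sums against bounded weights of bounded total
  variation.\<close>

lemma abel_sum_bound:
  fixes f g :: "nat \<Rightarrow> real"
  assumes C: "\<And>D. \<bar>\<Sum>d<D. f d\<bar> \<le> C" and B: "\<And>d. \<bar>g d\<bar> \<le> B"
    and V: "\<And>D. (\<Sum>d<D. \<bar>g (Suc d) - g d\<bar>) \<le> V"
  shows "\<bar>\<Sum>d<D. f d * g d\<bar> \<le> C * (B + V)"
proof -
  define F where "F D = (\<Sum>d<D. f d)" for D
  have C0: "C \<ge> 0" using C[of 0] by simp
  have parts: "(\<Sum>d<D. f d * g d) = F D * g D - (\<Sum>d<D. F (Suc d) * (g (Suc d) - g d))"
    by (induction D) (auto simp: F_def algebra_simps)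
  have "\<bar>\<Sum>d<D. F (Suc d) * (g (Suc d) - g d)\<bar> \<le> (\<Sum>d<D. \<bar>F (Suc d) * (g (Suc d) - g d)\<bar>)"
    by (rule sum_abs)
  also have "\<dots> \<le> (\<Sum>d<D. C * \<bar>g (Suc d) - g d\<bar>)"
    unfolding abs_mult F_def by (intro sum_mono mult_right_mono C) auto
  also have "\<dots> \<le> C * V" using V[of D] C0 by (simp add: sum_distrib_left[symmetric] mult_left_mono)
  finally have 1: "\<bar>\<Sum>d<D. F (Suc d) * (g (Suc d) - g d)\<bar> \<le> C * V" .
  have "\<bar>F D * g D\<bar> \<le> C * B"
    using C[of D] B[of D] C0 unfolding F_def abs_mult by (intro mult_mono) auto
  with 1 show ?thesis unfolding parts by (simp add: algebra_simps)
qed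

lemma power_series_summable:
  fixes f :: "nat \<Rightarrow> real"
  assumes "\<And>a. \<bar>f a\<bar> \<le> 1" "0 \<le> u" "u < 1"
  shows "summable (\<lambda>e. f e * u ^ e)"
  by (rule summable_comparison_test'[of "\<lambda>e. u ^ e" 0])
    (use assms in \<open>auto simp: abs_mult summable_geometric intro!: mult_left_le_one_le\<close>)

text \<open>The generating function is a rational function whose only possible singularity in the
  unit interval, a simple pole at 1, is cancelled by the vanishing of the sum over a period.\<close>

lemma periodic_generating_function_Lipschitz:
  fixes f :: "nat \<Rightarrow> real"
  assumes per: "\<And>a. f (a + M) = f a" and M: "M > 0" and zero: "(\<Sum>r<M. f r) = 0"
    and bd: "\<And>a. \<bar>f a\<bar> \<le> 1"
  obtains B L where "\<And>u. 0 \<le> u \<Longrightarrow> u < 1 \<Longrightarrow> \<bar>\<Sum>e. f e * u ^ e\<bar> \<le> B"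
    and "\<And>u v. 0 \<le> u \<Longrightarrow> u < 1 \<Longrightarrow> 0 \<le> v \<Longrightarrow> v < 1 \<Longrightarrow>
           \<bar>(\<Sum>e. f e * u ^ e) - (\<Sum>e. f e * v ^ e)\<bar> \<le> L * \<bar>u - v\<bar>"
    and "L \<ge> 0"
proof -
  define P where "P = (\<Sum>r<M. Polynomial.monom (f r) r)"
  have P: "poly P u = (\<Sum>r<M. f r * u ^ r)" for u
    by (simp add: P_def poly_sum Polynomial.poly_monom)
  have "poly P 1 = 0" using zero by (simp add: P)
  then obtain Q where Q: "P = [:-1, 1:] * Q"
    using poly_eq_0_iff_dvd by (metis dvdE)
  define R where "R = (\<Sum>r<M. Polynomial.monom (1::real) r)"
  have R: "poly R u = (\<Sum>r<M. u ^ r)" for u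
    by (simp add: R_def poly_sum Polynomial.poly_monom)
  \<comment> \<open>The constant term of \<open>R\<close> is 1 and no coefficient is negative, so
    the denominator has no zero on the closed unit interval, the point 1 included.\<close>
  have R1: "poly R u \<ge> 1" if "u \<ge> 0" for u
  proof -
    have "(\<Sum>r\<in>{0}. u ^ r) \<le> (\<Sum>r<M. u ^ r)"
      using M that by (intro sum_mono2) auto
    then show ?thesis by (simp add: R)
  qed
  define F where "F u = - poly Q u / poly R u" for u
  have eq: "(\<Sum>e. f e * u ^ e) = F u" if u: "0 \<le> u" "u < 1" for u
  proof -
    let ?S = "\<Sum>e. f e * u ^ e"
    have sm: "summable (\<lambda>e. f e * u ^ e)" using bd u by (rule power_series_summable)
    have "?S = (\<Sum>e. f (e + M) * u ^ (e + M)) + (\<Sum>e<M. f e * u ^ e)"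
      using sm by (rule suminf_split_initial_segment)
    also have "(\<Sum>e. f (e + M) * u ^ (e + M)) = (\<Sum>e. u ^ M * (f e * u ^ e))"
      by (simp add: per power_add mult_ac)
    also have "\<dots> = u ^ M * ?S" using sm by (rule suminf_mult)
    finally have "(1 - u ^ M) * ?S = poly P u" by (simp add: P algebra_simps)
    also have "1 - u ^ M = (1 - u) * poly R u" by (simp add: R one_diff_power_eq)
    also have "poly P u = (1 - u) * (- poly Q u)" by (simp add: Q algebra_simps)
    finally have "(1 - u) * (poly R u * ?S) = (1 - u) * (- poly Q u)" by (simp only: mult.assoc)
    then have "poly R u * ?S = - poly Q u" using u by (subst (asm) mult_left_cancel) auto
    then show ?thesis using R1[of u] u by (simp add: F_def field_simps)
  qed
  define F' where "F' u = (poly Q u * poly (pderiv R) u - poly (pderiv Q) u * poly R u) / (poly R u * poly R u)" for u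
  have R0: "poly R u \<noteq> 0" if "u \<in> {0..1}" for u
    using R1[of u] that by auto
  have "continuous_on {0..1} F" "continuous_on {0..1} F'"
    unfolding F_def F'_def using R0 by (auto intro!: continuous_intros)
  then have bF: "bounded (F ` {0..1})" "bounded (F' ` {0..1})"
    by (auto intro!: compact_imp_bounded compact_continuous_image)
  obtain B where B: "\<And>u. u \<in> {0..1} \<Longrightarrow> \<bar>F u\<bar> \<le> B"
    using bF(1) unfolding bounded_iff real_norm_def by blast
  obtain L where L: "\<And>u. u \<in> {0..1} \<Longrightarrow> \<bar>F' u\<bar> \<le> L"
    using bF(2) unfolding bounded_iff real_norm_def by blast
  have der: "(F has_field_derivative F' u) (at u within {0..1})" if "u \<in> {0..1}" for u
  proof -
    have "(F has_field_derivative ((- poly (pderiv Q) u) * poly R u - (- poly Q u) * poly (pderiv R) u)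
        / (poly R u * poly R u)) (at u within {0..1})"
      unfolding F_def
      by (intro DERIV_divide DERIV_minus has_field_derivative_at_within[OF poly_DERIV] R0 that)
    then show ?thesis by (simp add: F'_def)
  qed
  have lip: "\<bar>F u - F v\<bar> \<le> L * \<bar>u - v\<bar>" if "u \<in> {0..1}" "v \<in> {0..1}" for u v
    using field_differentiable_bound[of "{0..1}" F F' L u v] der L that by auto
  show thesis
  proof (rule that[of B L])
    show "L \<ge> 0" using L[of 0] by fastforce
    show "\<bar>\<Sum>e. f e * u ^ e\<bar> \<le> B" if "0 \<le> u" "u < 1" for u
      using B[of u] that eq[of u] by simp
    show "\<bar>(\<Sum>e. f e * u ^ e) - (\<Sum>e. f e * v ^ e)\<bar> \<le> L * \<bar>u - v\<bar>"
      if "0 \<le> u" "u < 1" "0 \<le> v" "v < 1" for u v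
      using lip[of u v] that eq[of u] eq[of v] by simp
  qed
qed

section \<open>Lambert series of pairs of characters\<close>

lemma geometric_product_summable:
  fixes t :: real
  assumes "0 < t" "t < 1"
  shows "(\<lambda>(d,e). t ^ d * t ^ e) summable_on (UNIV :: (nat \<times> nat) set)"
proof -
  have s: "((\<lambda>e. t ^ e) has_sum (1 / (1 - t))) (UNIV :: nat set)"
    using assms by (intro norm_summable_imp_has_sum) (auto simp: geometric_sums summable_geometric)
  have "(\<lambda>(d,e). t ^ d * t ^ e) summable_on (Sigma UNIV (\<lambda>_. UNIV) :: (nat \<times> nat) set)"
  proof (rule summable_on_SigmaI)
    fix d :: nat
    show "((\<lambda>e. case (d, e) of (d, e) \<Rightarrow> t ^ d * t ^ e) has_sum (t ^ d * (1 / (1 - t)))) (UNIV :: nat set)"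
      using has_sum_cmult_right[OF s, of "t ^ d"] by simp
  next
    show "(\<lambda>d. t ^ d * (1 / (1 - t))) summable_on (UNIV :: nat set)"
      using has_sum_cmult_left[OF s, of "1 / (1 - t)"] by (auto simp: summable_on_def)
  qed (use assms in auto)
  then show ?thesis by simp
qed

text \<open>For positive \<open>d\<close> and \<open>e\<close> one has
  \<open>d + e \<le> d * e + 1\<close>, so \<open>t ^ (d * e)\<close> is at most
  \<open>t ^ (d + e) / t\<close> and the geometric double series is a majorant. Pairs with a zero
  entry, where the power is 1, are removed by the vanishing at 0.\<close>

lemma lambert_summable:
  fixes \<alpha> \<beta> :: "nat \<Rightarrow> real"
  assumes t: "0 < t" "t < 1" and \<alpha>: "\<And>a. \<bar>\<alpha> a\<bar> \<le> 1" "\<alpha> 0 = 0" and \<beta>: "\<And>a. \<bar>\<beta> a\<bar> \<le> 1" "\<beta> 0 = 0"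
  shows "(\<lambda>(d,e). \<alpha> d * (\<beta> e * (t ^ d) ^ e)) summable_on UNIV"
proof (rule Infinite_Sum.abs_summable_summable, rule Infinite_Sum.abs_summable_on_comparison_test')
  show "(\<lambda>x. (1 / t) * (case x of (d,e) \<Rightarrow> t ^ d * t ^ e)) summable_on (UNIV :: (nat \<times> nat) set)"
    by (rule summable_on_cmult_right) (rule geometric_product_summable[OF t])
  fix x :: "nat \<times> nat"
  obtain d e where x: "x = (d, e)" by (cases x)
  have "\<bar>\<alpha> d * (\<beta> e * (t ^ d) ^ e)\<bar> \<le> (1 / t) * (t ^ d * t ^ e)"
  proof (cases "d = 0 \<or> e = 0")
    case True
    then show ?thesis using \<alpha>(2) \<beta>(2) t by auto
  next
    case False
    then obtain d' e' where "d = Suc d'" "e = Suc e'" by (meson not0_implies_Suc)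
    then have "d + e \<le> Suc (d * e)" by simp
    then have le: "t ^ Suc (d * e) \<le> t ^ (d + e)" using t by (intro power_decreasing) auto
    have le1: "\<bar>\<alpha> d\<bar> * \<bar>\<beta> e\<bar> \<le> 1"
      using \<alpha>(1) \<beta>(1) by (intro mult_le_one) auto
    have "\<bar>\<alpha> d * (\<beta> e * (t ^ d) ^ e)\<bar> = (\<bar>\<alpha> d\<bar> * \<bar>\<beta> e\<bar>) * t ^ (d * e)"
      using t by (simp add: abs_mult power_mult)
    also have "\<dots> \<le> 1 * t ^ (d * e)"
      using t by (intro mult_right_mono le1) auto
    also have "\<dots> = (1 / t) * t ^ Suc (d * e)" using t by simp
    also have "\<dots> \<le> (1 / t) * (t ^ d * t ^ e)"
      unfolding power_add[symmetric] using le t by (intro mult_left_mono) auto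
    finally show ?thesis .
  qed
  then show "norm (case x of (d,e) \<Rightarrow> \<alpha> d * (\<beta> e * (t ^ d) ^ e)) \<le> (1 / t) * (case x of (d,e) \<Rightarrow> t ^ d * t ^ e)"
    by (simp add: x)
qed

lemma has_sum_imp_tendsto_partial_sums:
  fixes f :: "nat \<Rightarrow> real"
  assumes "(f has_sum S) UNIV"
  shows "(\<lambda>D. \<Sum>d<D. f d) \<longlonglongrightarrow> S"
  using has_sum_imp_sums[OF assms] unfolding sums_def .

text \<open>Summing over \<open>e\<close> first leaves the series of
  \<open>\<alpha> d * \<Theta> (t ^ d)\<close>. As \<open>\<Theta>\<close> is bounded and Lipschitz
  below 1 and \<open>t ^ d\<close> is monotone in \<open>d\<close>, the weights have total variation
  at most \<open>L\<close> for every \<open>t\<close>; summation by parts then gives a bound uniform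
  in \<open>t\<close>.\<close>

lemma lambert_sum_bounded:
  fixes \<alpha> \<beta> :: "nat \<Rightarrow> real"
  assumes \<alpha>: "real_character M \<alpha>" "\<alpha> a = -1" and \<beta>: "real_character M \<beta>" "\<beta> b = -1"
    and M: "M > 1"
  obtains C where "\<And>t S. 0 < t \<Longrightarrow> t < 1 \<Longrightarrow>
    ((\<lambda>(d,e). \<alpha> d * (\<beta> e * (t ^ d) ^ e)) has_sum S) UNIV \<Longrightarrow> \<bar>S\<bar> \<le> C"
proof -
  have M0: "M > 0" using M by simp
  have z: "(\<Sum>r<M. \<alpha> r) = 0" "(\<Sum>r<M. \<beta> r) = 0"
    using real_character_sum_0 \<alpha> \<beta> M0 by blast+
  define \<Theta> where "\<Theta> u = (\<Sum>e. \<beta> e * u ^ e)" for u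
  obtain B L where B: "\<And>u. 0 \<le> u \<Longrightarrow> u < 1 \<Longrightarrow> \<bar>\<Theta> u\<bar> \<le> B"
    and L: "\<And>u v. 0 \<le> u \<Longrightarrow> u < 1 \<Longrightarrow> 0 \<le> v \<Longrightarrow> v < 1 \<Longrightarrow> \<bar>\<Theta> u - \<Theta> v\<bar> \<le> L * \<bar>u - v\<bar>"
    and L0: "L \<ge> 0"
    using periodic_generating_function_Lipschitz[OF real_character_periodic[OF \<beta>(1)] M0 z(2)
        real_character_abs_le[OF \<beta>(1)]] unfolding \<Theta>_def by blast
  define C where "C = (\<Sum>d<M. \<bar>\<alpha> d\<bar>) * (B + L)"
  show thesis
  proof (rule that[of C])
    fix t S :: real
    assume t: "0 < t" "t < 1"
      and S: "((\<lambda>(d,e). \<alpha> d * (\<beta> e * (t ^ d) ^ e)) has_sum S) UNIV"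
    \<comment> \<open>\<open>\<Theta>\<close> is controlled only below 1, so the argument
      \<open>t ^ 0\<close> must be avoided. Because \<open>\<alpha> 0 = 0\<close>, the value at
      \<open>d = 0\<close> is free, and \<open>\<Theta> t\<close> makes the first difference
      vanish.\<close>
    define g where "g d = (if d = 0 then \<Theta> t else \<Theta> (t ^ d))" for d
    have inner: "((\<lambda>e. \<alpha> d * (\<beta> e * (t ^ d) ^ e)) has_sum (\<alpha> d * g d)) UNIV" for d
    proof (cases "d = 0")
      case True
      then show ?thesis using real_character_0[OF \<alpha>(1) M] by simp
    next
      case False
      then have u: "0 \<le> t ^ d" "t ^ d < 1" using t by (auto simp: power_less_one_iff)
      have "((\<lambda>e. \<beta> e * (t ^ d) ^ e) has_sum \<Theta> (t ^ d)) UNIV"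
      proof (rule norm_summable_imp_has_sum)
        show "summable (\<lambda>e. norm (\<beta> e * (t ^ d) ^ e))"
          using power_series_summable[of "\<lambda>e. \<bar>\<beta> e\<bar>" "t ^ d"] u real_character_abs_le[OF \<beta>(1)]
          t by (simp add: abs_mult)
        then have "summable (\<lambda>e. \<beta> e * (t ^ d) ^ e)" by (rule summable_norm_cancel)
        then show "(\<lambda>e. \<beta> e * (t ^ d) ^ e) sums \<Theta> (t ^ d)"
          unfolding \<Theta>_def by (rule summable_sums)
      qed
      then show ?thesis unfolding g_def using False by (simp add: has_sum_cmult_right)
    qed
    have "((\<lambda>d. \<alpha> d * g d) has_sum S) UNIV"
      by (rule has_sum_Sigma'[where B = "\<lambda>_. UNIV" and f = "\<lambda>(d,e). \<alpha> d * (\<beta> e * (t ^ d) ^ e)"])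
        (use S inner in auto)
    then have lim: "(\<lambda>D. \<Sum>d<D. \<alpha> d * g d) \<longlonglongrightarrow> S" by (rule has_sum_imp_tendsto_partial_sums)
    have "\<bar>\<Sum>d<D. \<alpha> d * g d\<bar> \<le> C" for D
      unfolding C_def
    proof (rule abel_sum_bound)
      show "\<bar>\<Sum>d<D. \<alpha> d\<bar> \<le> (\<Sum>d<M. \<bar>\<alpha> d\<bar>)" for D
        using periodic_partial_sums_bounded[OF real_character_periodic[OF \<alpha>(1)] M0 z(1)] .
      show "\<bar>g d\<bar> \<le> B" for d
        using B[of t] B[of "t ^ d"] t by (auto simp: g_def power_less_one_iff)
      have step: "\<bar>g (Suc d) - g d\<bar> \<le> L * ((if d = 0 then t else t ^ d) - t ^ Suc d)" for d
      proof (cases "d = 0")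
        case False
        have "t ^ Suc d \<le> t ^ d" using t by (intro power_decreasing) auto
        moreover have "t ^ Suc d < 1" "t ^ d < 1"
          using t False by (simp_all only: power_less_one_iff) auto
        ultimately show ?thesis
          using L[of "t ^ Suc d" "t ^ d"] t False by (simp add: g_def)
      qed (simp add: g_def)
      have "(\<Sum>d<D. (if d = 0 then t else t ^ d) - t ^ Suc d) = (if D = 0 then 0 else t - t ^ D)" for D
        by (induction D) auto
      then have tel: "(\<Sum>d<D. (if d = 0 then t else t ^ d) - t ^ Suc d) \<le> 1" for D
        using t by (simp add: diff_le_eq add_increasing2)
      show "(\<Sum>d<D. \<bar>g (Suc d) - g d\<bar>) \<le> L" for D
      proof -
        have "(\<Sum>d<D. \<bar>g (Suc d) - g d\<bar>) \<le> L * (\<Sum>d<D. (if d = 0 then t else t ^ d) - t ^ Suc d)"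
          unfolding sum_distrib_left by (rule sum_mono) (rule step)
        also have "\<dots> \<le> L * 1" by (rule mult_left_mono[OF tel L0])
        finally show ?thesis by simp
      qed
    qed
    then show "\<bar>S\<bar> \<le> C"
      by (intro LIMSEQ_le_const2[OF tendsto_rabs[OF lim]]) blast
  qed
qed

text \<open>The terms are collected by \<open>q = d * e\<close>. Vanishing at 0 removes the pairs
  with product 0, so that only finite sets of divisors remain.\<close>

lemma lambert_regroup:
  fixes \<alpha> \<beta> :: "nat \<Rightarrow> real"
  assumes S: "((\<lambda>(d,e). \<alpha> d * (\<beta> e * (t ^ d) ^ e)) has_sum S) UNIV" and z: "\<alpha> 0 = 0" "\<beta> 0 = 0"
  shows "((\<lambda>q. (\<Sum>d | d dvd q. \<alpha> d * \<beta> (q div d)) * t ^ q) has_sum S) {1..}"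
proof -
  let ?f = "\<lambda>(d,e). \<alpha> d * (\<beta> e * (t ^ d) ^ e)"
  have "(?f has_sum S) ({1..} \<times> {1..})"
    using S by (rule has_sum_cong_neutral[THEN iffD1, rotated -1]) (use z in \<open>auto simp: not_le Suc_le_eq intro: gr0I\<close>)
  also have "(?f has_sum S) ({1..} \<times> {1..}) \<longleftrightarrow>
      ((\<lambda>(q,d). \<alpha> d * \<beta> (q div d) * t ^ q) has_sum S) (Sigma {1..} (\<lambda>q. {d. d dvd q}))"
    by (rule has_sum_reindex_bij_witness[where j = "\<lambda>(d,e). (d * e, d)" and i = "\<lambda>(q,d). (d, q div d)"])
      (auto simp: power_mult dvd_div_eq_0_iff Suc_le_eq elim!: dvdE)
  finally have "((\<lambda>(q,d). \<alpha> d * \<beta> (q div d) * t ^ q) has_sum S) (Sigma {1..} (\<lambda>q. {d. d dvd q}))" .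
  then show ?thesis
  proof (rule has_sum_Sigma')
    fix q :: nat assume "q \<in> {1..}"
    then have "finite {d. d dvd q}" by (simp add: finite_divisors_nat)
    then show "((\<lambda>d. case (q, d) of (q, d) \<Rightarrow> \<alpha> d * \<beta> (q div d) * t ^ q) has_sum
        (\<Sum>d | d dvd q. \<alpha> d * \<beta> (q div d)) * t ^ q) {d. d dvd q}"
      by (simp add: sum_distrib_right has_sum_finite)
  qed
qed

section \<open>Prescribing values of real characters\<close>

text \<open>Multiplicativity of the divisor sum, one prime at a time: a divisor of
  \<open>p ^ k * u\<close> is \<open>p ^ i * d\<close> with unique \<open>i \<le> k\<close> and
  \<open>d dvd u\<close>.\<close>

lemma divisor_sum_prime_power_mult:
  fixes \<phi> :: "nat \<Rightarrow> real"
  assumes mult: "\<And>a b. \<phi> (a * b) = \<phi> a * \<phi> b" and one: "\<phi> 1 = 1"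
    and p: "prime p" "\<not> p dvd u"
  shows "(\<Sum>d | d dvd p ^ k * u. \<phi> d) = (\<Sum>i\<le>k. \<phi> p ^ i) * (\<Sum>d | d dvd u. \<phi> d)"
proof -
  have cop: "coprime (p ^ i) d" if "d dvd u" for i d
    using p that by (meson coprime_power_left_iff dvd_trans prime_imp_coprime)
  have pow: "\<phi> (p ^ i) = \<phi> p ^ i" for i
    by (induction i) (use one mult in auto)
  have p1: "p > 1" using p(1) by (rule prime_gt_1_nat)
  have bij: "bij_betw (\<lambda>(i,d). p ^ i * d) ({..k} \<times> {d. d dvd u}) {d. d dvd p ^ k * u}"
  proof (rule bij_betw_imageI)
    show "inj_on (\<lambda>(i,d). p ^ i * d) ({..k} \<times> {d. d dvd u})"
    proof (rule inj_onI, clarify)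
      fix i d j e assume *: "d dvd u" "e dvd u" "p ^ i * d = p ^ j * e"
      have "p ^ i dvd p ^ j" "p ^ j dvd p ^ i"
        using * cop by (metis coprime_dvd_mult_left_iff dvd_triv_left)+
      then have "p ^ i = p ^ j" by (rule dvd_antisym)
      then show "i = j \<and> d = e" using * p1 by simp
    qed
    show "(\<lambda>(i,d). p ^ i * d) ` ({..k} \<times> {d. d dvd u}) = {d. d dvd p ^ k * u}"
    proof (intro equalityI subsetI)
      fix x assume "x \<in> {d. d dvd p ^ k * u}"
      then obtain a b where "x = a * b" "a dvd p ^ k" "b dvd u"
        by (auto elim: dvd_productE)
      moreover from this obtain i where "a = p ^ i" "i \<le> k"
        using p(1) divides_primepow_nat by blast
      ultimately show "x \<in> (\<lambda>(i,d). p ^ i * d) ` ({..k} \<times> {d. d dvd u})" by force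
    qed (auto intro!: mult_dvd_mono le_imp_power_dvd)
  qed
  have "(\<Sum>d | d dvd p ^ k * u. \<phi> d) = (\<Sum>(i,d)\<in>{..k} \<times> {d. d dvd u}. \<phi> (p ^ i * d))"
    using sum.reindex_bij_betw[OF bij, of \<phi>] by (simp add: case_prod_unfold)
  also have "\<dots> = (\<Sum>(i,d)\<in>{..k} \<times> {d. d dvd u}. \<phi> p ^ i * \<phi> d)"
    by (simp add: mult pow)
  finally show ?thesis by (simp add: sum_product sum.cartesian_product)
qed

text \<open>The local factor at a prime \<open>p\<close>, with \<open>x = \<phi> p\<close>: it is 1
  for \<open>x = 0\<close>, \<open>k + 1\<close> for \<open>x = 1\<close>, and alternately 1 and 0
  for \<open>x = -1\<close>.\<close>

lemma geometric_sum_sign: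
  fixes x :: real
  assumes "x = 0 \<or> x = 1 \<or> x = -1"
  shows "(\<Sum>i\<le>k. x ^ i) \<ge> 0" and "even k \<Longrightarrow> (\<Sum>i\<le>k. x ^ i) \<ge> 1"
    and "odd k \<Longrightarrow> x = -1 \<Longrightarrow> (\<Sum>i\<le>k. x ^ i) = 0"
proof -
  have 0: "(\<Sum>i\<le>k. (0::real) ^ i) = 1" by (induction k) auto
  have 1: "(\<Sum>i\<le>k. (-1::real) ^ i) = (if even k then 1 else 0)" by (induction k) auto
  show "(\<Sum>i\<le>k. x ^ i) \<ge> 0" "even k \<Longrightarrow> (\<Sum>i\<le>k. x ^ i) \<ge> 1"
    "odd k \<Longrightarrow> x = -1 \<Longrightarrow> (\<Sum>i\<le>k. x ^ i) = 0"
    using assms 0 1 by auto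
qed

lemma nat_split_prime_power:
  fixes q :: nat
  assumes "prime p" "q > 0"
  obtains u where "q = p ^ multiplicity p q * u" "\<not> p dvd u" "u > 0"
  using multiplicity_decompose'[of q p] assms by (metis gr0I mult_0_right not_prime_unit not_gr0)

lemma divisor_sum_nonneg:
  assumes \<phi>: "real_character M \<phi>" and "q > 0"
  shows "(\<Sum>d | d dvd q. \<phi> d) \<ge> 0"
  using assms(2)
proof (induction q rule: less_induct)
  case (less q)
  show ?case
  proof (cases "q = 1")
    case True
    then show ?thesis using real_character_1[OF \<phi>] by simp
  next
    case False
    then obtain p where p: "prime p" "p dvd q" using prime_factor_nat by blast
    obtain u where u: "q = p ^ multiplicity p q * u" "\<not> p dvd u" "u > 0"
      using nat_split_prime_power p less.prems by blast
    have "u < q" using u p by (metis dvd_triv_right less.prems le_neq_implies_less dvd_imp_le)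
    then have "(\<Sum>d | d dvd u. \<phi> d) \<ge> 0" using less.IH u(3) by blast
    then have "(\<Sum>d | d dvd p ^ multiplicity p q * u. \<phi> d) \<ge> 0"
      unfolding divisor_sum_prime_power_mult[OF real_character_mult[OF \<phi>] real_character_1[OF \<phi>] p(1) u(2)]
      using geometric_sum_sign(1)[OF real_character_cases[OF \<phi>]] by (intro mult_nonneg_nonneg) auto
    then show ?thesis using u(1) by simp
  qed
qed

text \<open>All exponents of a square are even, so every local factor is at least 1. These terms
  later force the divergence.\<close>

lemma divisor_sum_square_ge_1:
  assumes \<phi>: "real_character M \<phi>" and "k > 0"
  shows "(\<Sum>d | d dvd k\<^sup>2. \<phi> d) \<ge> 1"
  using assms(2)
proof (induction k rule: less_induct)
  case (less k)
  show ?case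
  proof (cases "k = 1")
    case True
    then show ?thesis using real_character_1[OF \<phi>] by simp
  next
    case False
    then obtain p where p: "prime p" "p dvd k" using prime_factor_nat by blast
    obtain u m where u: "k = p ^ m * u" "\<not> p dvd u" "u > 0"
      using nat_split_prime_power p less.prems by blast
    have "u < k" using u p by (metis dvd_triv_right less.prems le_neq_implies_less dvd_imp_le)
    then have IH: "(\<Sum>d | d dvd u\<^sup>2. \<phi> d) \<ge> 1" using less.IH u(3) by blast
    have k2: "k\<^sup>2 = p ^ (2 * m) * u\<^sup>2"
      unfolding u(1) by (simp add: power_mult_distrib power_mult[symmetric] mult.commute)
    have pu: "\<not> p dvd u\<^sup>2" using u(2) p(1) prime_dvd_power by blast
    have "1 * 1 \<le> (\<Sum>i\<le>2 * m. \<phi> p ^ i) * (\<Sum>d | d dvd u\<^sup>2. \<phi> d)"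
      using geometric_sum_sign(1,2)[OF real_character_cases[OF \<phi>], of "2 * m" p] IH
      by (intro mult_mono) auto
    also have "\<dots> = (\<Sum>d | d dvd k\<^sup>2. \<phi> d)"
      unfolding k2 divisor_sum_prime_power_mult[OF real_character_mult[OF \<phi>] real_character_1[OF \<phi>] p(1) pu] ..
    finally show ?thesis by simp
  qed
qed

text \<open>An odd power of a prime with value -1 contributes the local factor 0.\<close>

lemma divisor_sum_nonzero_imp:
  assumes \<phi>: "real_character M \<phi>" and "q > 0" "(\<Sum>d | d dvd q. \<phi> d) \<noteq> 0"
    and p: "prime p" "odd (multiplicity p q)"
  shows "\<phi> p \<noteq> -1"
proof
  assume m1: "\<phi> p = -1"
  obtain u where u: "q = p ^ multiplicity p q * u" "\<not> p dvd u"
    using nat_split_prime_power p(1) assms(2) by blast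
  have "(\<Sum>d | d dvd p ^ multiplicity p q * u. \<phi> d) = 0"
    unfolding divisor_sum_prime_power_mult[OF real_character_mult[OF \<phi>] real_character_1[OF \<phi>] p(1) u(2)]
    using geometric_sum_sign(3)[OF real_character_cases[OF \<phi>] p(2)] m1 by simp
  then show False using u(1) assms(3) by simp
qed

text \<open>Since \<open>\<psi> d * \<psi> (q div d) = \<psi> q\<close>, twisting the divisor sums
  of \<open>\<phi>\<close> by \<open>\<psi>\<close> gives the Lambert series of
  \<open>\<psi>\<close> and \<open>\<psi> * \<phi>\<close>.\<close>

lemma lambert_convolution_sum:
  assumes \<psi>: "real_character M \<psi>" and \<phi>: "real_character M \<phi>" and M: "M > 1"
    and t: "0 < t" "t < 1"
  obtains S where "((\<lambda>(d,e). \<psi> d * (\<psi> e * \<phi> e * (t ^ d) ^ e)) has_sum S) UNIV"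
    and "((\<lambda>q. \<psi> q * ((\<Sum>d | d dvd q. \<phi> d) * t ^ q)) has_sum S) {1..}"
proof -
  let ?\<beta> = "\<lambda>e. \<psi> e * \<phi> e"
  have \<beta>: "real_character M ?\<beta>" using real_character_times \<psi> \<phi> .
  have "(\<lambda>(d,e). \<psi> d * (?\<beta> e * (t ^ d) ^ e)) summable_on UNIV"
    by (rule lambert_summable)
      (use t real_character_abs_le[OF \<psi>] real_character_0[OF \<psi> M]
        real_character_abs_le[OF \<beta>] real_character_0[OF \<beta> M] in auto)
  then obtain S where S: "((\<lambda>(d,e). \<psi> d * (?\<beta> e * (t ^ d) ^ e)) has_sum S) UNIV"
    unfolding summable_on_def by blast
  have "((\<lambda>q. (\<Sum>d | d dvd q. \<psi> d * ?\<beta> (q div d)) * t ^ q) has_sum S) {1..}"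
    by (rule lambert_regroup[OF S]) (use real_character_0[OF \<psi> M] in auto)
  moreover have "(\<Sum>d | d dvd q. \<psi> d * ?\<beta> (q div d)) = \<psi> q * (\<Sum>d | d dvd q. \<phi> d)" if "q \<in> {1..}" for q
  proof -
    have "(\<Sum>d | d dvd q. \<psi> d * ?\<beta> (q div d)) = (\<Sum>d | d dvd q. \<psi> q * \<phi> (q div d))"
      using real_character_mult[OF \<psi>] by (intro sum.cong) (auto simp: mult.assoc[symmetric] simp flip: real_character_mult[OF \<psi>])
    also have "\<dots> = \<psi> q * (\<Sum>d | d dvd q. \<phi> (q div d))" by (simp add: sum_distrib_left)
    also have "(\<Sum>d | d dvd q. \<phi> (q div d)) = (\<Sum>d | d dvd q. \<phi> d)"
      using that by (intro sum.reindex_bij_witness[of _ "\<lambda>d. q div d" "\<lambda>d. q div d"]) auto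
    finally show ?thesis .
  qed
  ultimately have "((\<lambda>q. \<psi> q * ((\<Sum>d | d dvd q. \<phi> d) * t ^ q)) has_sum S) {1..}"
    by (subst has_sum_cong[where g = "\<lambda>q. (\<Sum>d | d dvd q. \<psi> d * ?\<beta> (q div d)) * t ^ q"]) auto
  with S show thesis by (rule that)
qed

lemma has_sum_finite_sum:
  fixes f :: "'i \<Rightarrow> 'a \<Rightarrow> real"
  assumes "finite J" "\<And>i. i \<in> J \<Longrightarrow> (f i has_sum S i) A"
  shows "((\<lambda>x. \<Sum>i\<in>J. f i x) has_sum (\<Sum>i\<in>J. S i)) A"
  using assms by (induction J rule: finite_induct) (auto intro: has_sum_add)

text \<open>Expanding the product of the factors \<open>1 + \<epsilon> i * \<psi> i q\<close> expresses the generating function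
  of the divisor sums over the wanted \<open>q\<close> through Lambert series, of which all but the first stay
  bounded as \<open>t\<close> tends to 1, while the first one is at least a sum over squares and diverges.\<close>

lemma prescribed_real_characters:
  fixes \<phi> :: "nat \<Rightarrow> real" and \<psi> :: "'i \<Rightarrow> nat \<Rightarrow> real" and \<epsilon> :: "'i \<Rightarrow> real"
  assumes M: "M > 1" and \<phi>: "real_character M \<phi>" and I: "finite I"
    and \<psi>: "\<And>i. i \<in> I \<Longrightarrow> real_character M (\<psi> i)"
    and \<epsilon>: "\<And>i. i \<in> I \<Longrightarrow> \<epsilon> i = 1 \<or> \<epsilon> i = -1"
    and indep: "\<And>i. i \<in> I \<Longrightarrow> \<exists>a. \<psi> i a = -1 \<and> (\<forall>j\<in>I - {i}. \<psi> j a = 1)"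
    and indep': "\<phi> b = -1" "\<And>i. i \<in> I \<Longrightarrow> \<psi> i b = 1"
  obtains q where "q > 0" "coprime q M" "(\<Sum>d | d dvd q. \<phi> d) \<noteq> 0" "\<And>i. i \<in> I \<Longrightarrow> \<psi> i q = \<epsilon> i"
proof (rule ccontr)
  note * = that
  assume "\<not> thesis"
  then have no: "\<exists>i\<in>I. \<psi> i q \<noteq> \<epsilon> i"
    if "q > 0" "coprime q M" "(\<Sum>d | d dvd q. \<phi> d) \<noteq> 0" for q
    using *[of q] that by blast
  \<comment> \<open>For \<open>T = {}\<close> this is the principal character, which carries the
    main term.\<close>
  define \<Psi> where "\<Psi> T a = (if coprime a M then 1 else 0) * (\<Prod>i\<in>T. \<psi> i a)" for T a
  define E where "E T = (\<Prod>i\<in>T. \<epsilon> i)" for T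
  define f where "f q = (\<Sum>d | d dvd q. \<phi> d)" for q
  define L where "L T t S \<longleftrightarrow> ((\<lambda>(d,e). \<Psi> T d * (\<Psi> T e * \<phi> e * (t ^ d) ^ e)) has_sum S) UNIV" for T t S
  define J where "J = Pow I - {{}}"
  have finT: "finite T" if "T \<in> Pow I" for T using that I finite_subset by blast
  have \<Psi>: "real_character M (\<Psi> T)" if "T \<in> Pow I" for T
    unfolding \<Psi>_def using that \<psi> finT by (intro real_character_prod) auto
  \<comment> \<open>Both characters of the pair are nonprincipal: the number \<open>a\<close>
    belonging to one member of \<open>T\<close> gives -1 for \<open>\<Psi> T\<close>, and
    \<open>b\<close> gives -1 for its product with \<open>\<phi>\<close>.\<close>
  have "\<exists>C. \<forall>t S. 0 < t \<longrightarrow> t < 1 \<longrightarrow>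
    L T t S \<longrightarrow> \<bar>S\<bar> \<le> C" if T: "T \<in> J" for T
  proof -
    have TI: "T \<in> Pow I" using T J_def by blast
    obtain i where i: "i \<in> T" "i \<in> I" using T J_def by blast
    then obtain a where a: "\<psi> i a = -1" "\<forall>j\<in>I - {i}. \<psi> j a = 1" using indep by blast
    have "coprime a M" using a(1) real_character_not_coprime[OF \<psi>[OF i(2)]] by force
    moreover have "(\<Prod>j\<in>T. \<psi> j a) = \<psi> i a * (\<Prod>j\<in>T - {i}. \<psi> j a)"
      using i finT[OF TI] by (simp add: prod.remove)
    moreover have "(\<Prod>j\<in>T - {i}. \<psi> j a) = 1" using a(2) TI by (intro prod.neutral) auto
    ultimately have 1: "\<Psi> T a = -1" using a(1) by (simp add: \<Psi>_def)
    have "coprime b M" using indep'(1) real_character_not_coprime[OF \<phi>] by force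
    moreover have "(\<Prod>j\<in>T. \<psi> j b) = 1" using indep'(2) TI by (intro prod.neutral) auto
    ultimately have 2: "\<Psi> T b * \<phi> b = -1" using indep'(1) by (simp add: \<Psi>_def)
    obtain C where "\<And>t S. 0 < t \<Longrightarrow> t < 1 \<Longrightarrow> L T t S \<Longrightarrow> \<bar>S\<bar> \<le> C"
      unfolding L_def using lambert_sum_bounded[OF \<Psi>[OF TI] 1 real_character_times[OF \<Psi>[OF TI] \<phi>] 2 M] by blast
    then show ?thesis by blast
  qed
  then obtain C where C: "\<And>T t S. T \<in> J \<Longrightarrow> 0 < t \<Longrightarrow> t < 1 \<Longrightarrow>
    L T t S \<Longrightarrow> \<bar>S\<bar> \<le> C T"
    by metis
  \<comment> \<open>For \<open>q\<close> coprime to \<open>M\<close> the sum over subsets expands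
    the product of the \<open>1 + \<epsilon> i * \<psi> i q\<close>. If moreover \<open>f q\<close>
    is nonzero, the assumption for contradiction supplies a wrong sign, which makes one factor
    0.\<close>
  have zero: "(\<Sum>T\<in>Pow I. E T * \<Psi> T q) * f q = 0" if q: "q \<in> {1..}" for q
  proof (cases "coprime q M \<and> f q \<noteq> 0")
    case True
    then obtain i where i: "i \<in> I" "\<psi> i q \<noteq> \<epsilon> i"
      using no[of q] q unfolding f_def by auto
    have "\<psi> i q = - \<epsilon> i"
      using real_character_coprime[OF \<psi>[OF i(1)], of q] True i \<epsilon>[OF i(1)] by auto
    then have "1 + \<epsilon> i * \<psi> i q = 0" using \<epsilon>[OF i(1)] by auto
    then have "(\<Prod>i\<in>I. \<epsilon> i * \<psi> i q + 1) = 0" using i(1) I by (intro prod_zero) (auto simp: add.commute)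
    also have "(\<Prod>i\<in>I. \<epsilon> i * \<psi> i q + 1) = (\<Sum>T\<in>Pow I. E T * \<Psi> T q)"
      using I True unfolding prod_add[OF I] by (simp add: E_def \<Psi>_def prod.distrib)
    finally show ?thesis by simp
  qed (auto simp: \<Psi>_def)
  define K where "K = (\<Sum>T\<in>J. C T)"
  \<comment> \<open>The \<open>(1 + M * j)^2\<close> are squares coprime to \<open>M\<close>, so
    each adds at least its power of \<open>t\<close> to the series of \<open>T = {}\<close>. That
    series equals minus the signed sum of the bounded ones.\<close>
  have bound: "(\<Sum>j<N. t ^ (1 + M * j)\<^sup>2) \<le> K" if t: "0 < t" "t < 1" for t :: real and N :: nat
  proof -
    have "\<exists>S. L T t S \<and>
        ((\<lambda>q. \<Psi> T q * (f q * t ^ q)) has_sum S) {1..}" if "T \<in> Pow I" for T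
      unfolding f_def L_def by (rule lambert_convolution_sum[OF \<Psi>[OF that] \<phi> M t]) blast
    then obtain S where S: "\<And>T. T \<in> Pow I \<Longrightarrow> L T t (S T)"
      and S': "\<And>T. T \<in> Pow I \<Longrightarrow> ((\<lambda>q. \<Psi> T q * (f q * t ^ q)) has_sum S T) {1..}"
      by metis
    have "((\<lambda>q. \<Sum>T\<in>Pow I. E T * (\<Psi> T q * (f q * t ^ q))) has_sum (\<Sum>T\<in>Pow I. E T * S T)) {1..}"
      using I S' by (intro has_sum_finite_sum has_sum_cmult_right) auto
    moreover have "(\<Sum>T\<in>Pow I. E T * (\<Psi> T q * (f q * t ^ q))) = 0" if "q \<in> {1..}" for q
      using zero[OF that] by (simp add: sum_distrib_right[symmetric] mult.assoc[symmetric])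
    ultimately have "((\<lambda>_. 0) has_sum (\<Sum>T\<in>Pow I. E T * S T)) {1::nat..}"
      by (subst has_sum_cong[where g = "\<lambda>q. \<Sum>T\<in>Pow I. E T * (\<Psi> T q * (f q * t ^ q))"]) auto
    then have "(\<Sum>T\<in>Pow I. E T * S T) = 0" by (rule has_sum_unique) simp
    moreover have "(\<Sum>T\<in>Pow I. E T * S T) = S {} + (\<Sum>T\<in>J. E T * S T)"
      unfolding J_def using I by (subst sum.remove[of _ "{}"]) (auto simp: E_def)
    ultimately have "S {} = (\<Sum>T\<in>J. - E T * S T)" by (simp add: sum_negf)
    also have "\<dots> \<le> K" unfolding K_def
    proof (rule sum_mono)
      fix T assume T: "T \<in> J"
      have "\<bar>E T\<bar> = 1" unfolding E_def abs_prod
        using \<epsilon> T J_def by (intro prod.neutral) fastforce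
      then have "- E T * S T \<le> \<bar>S T\<bar>" by (metis abs_ge_self abs_minus_cancel abs_mult mult_1)
      also have "\<dots> \<le> C T" using C[OF T t S] T J_def by blast
      finally show "- E T * S T \<le> C T" .
    qed
    finally have SK: "S {} \<le> K" .
    have inj: "inj_on (\<lambda>j. (1 + M * j)\<^sup>2) {..<N}"
      using M by (auto intro!: inj_onI)
    have copj: "coprime ((1 + M * j)\<^sup>2) M" for j
    proof -
      have "coprime (1 + M * j) M"
        by (rule coprimeI) (metis dvd_add_left_iff dvd_mult2)
      then show ?thesis by simp
    qed
    have "(\<Sum>j<N. t ^ (1 + M * j)\<^sup>2) \<le> (\<Sum>j<N. \<Psi> {} ((1 + M * j)\<^sup>2) * (f ((1 + M * j)\<^sup>2) * t ^ (1 + M * j)\<^sup>2))"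
    proof (rule sum_mono)
      fix j
      have "1 * t ^ (1 + M * j)\<^sup>2 \<le> f ((1 + M * j)\<^sup>2) * t ^ (1 + M * j)\<^sup>2"
        unfolding f_def using t by (intro mult_right_mono divisor_sum_square_ge_1[OF \<phi>]) auto
      then show "t ^ (1 + M * j)\<^sup>2 \<le> \<Psi> {} ((1 + M * j)\<^sup>2) * (f ((1 + M * j)\<^sup>2) * t ^ (1 + M * j)\<^sup>2)"
        using copj[of j] by (simp add: \<Psi>_def)
    qed
    also have "\<dots> = (\<Sum>q\<in>(\<lambda>j. (1 + M * j)\<^sup>2) ` {..<N}. \<Psi> {} q * (f q * t ^ q))"
      by (simp only: sum.reindex[OF inj] o_def)
    also have "\<dots> \<le> S {}"
      by (rule finite_sum_le_has_sum[OF S'])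
        (use t divisor_sum_nonneg[OF \<phi>] in \<open>auto simp: f_def \<Psi>_def\<close>)
    finally show ?thesis using SK by simp
  qed
  \<comment> \<open>Letting \<open>t\<close> tend to 1 from below turns the bound into one for the
    number of terms, which is arbitrary.\<close>
  have "real N \<le> K" for N
  proof -
    have "((\<lambda>t. \<Sum>j<N. t ^ (1 + M * j)\<^sup>2) \<longlongrightarrow> (\<Sum>j<N. 1 ^ (1 + M * j)\<^sup>2)) (at_left (1::real))"
      by (intro tendsto_intros)
    moreover have "\<forall>\<^sub>F t in at_left (1::real). (\<Sum>j<N. t ^ (1 + M * j)\<^sup>2) \<le> K"
      unfolding eventually_at_left_field using bound by (intro exI[of _ 0]) auto
    ultimately have "(\<Sum>j<N. 1 ^ (1 + M * j)\<^sup>2) \<le> K"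
      by (rule tendsto_upperbound) simp
    then show ?thesis by simp
  qed
  then show False by (meson not_le reals_Archimedean2)
qed

text \<open>Passing to the squarefree part drops a square coprime to \<open>M\<close>, on which
  every \<open>\<psi> i\<close> is 1. The remaining primes have odd multiplicity in the original
  number, so the nonzero divisor sum excludes the value -1 there.\<close>

lemma prescribed_real_characters_squarefree:
  fixes \<phi> :: "nat \<Rightarrow> real" and \<psi> :: "'i \<Rightarrow> nat \<Rightarrow> real" and \<epsilon> :: "'i \<Rightarrow> real"
  assumes M: "M > 1" and \<phi>: "real_character M \<phi>" and I: "finite I"
    and \<psi>: "\<And>i. i \<in> I \<Longrightarrow> real_character M (\<psi> i)"
    and \<epsilon>: "\<And>i. i \<in> I \<Longrightarrow> \<epsilon> i = 1 \<or> \<epsilon> i = -1"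
    and indep: "\<And>i. i \<in> I \<Longrightarrow> \<exists>a. \<psi> i a = -1 \<and> (\<forall>j\<in>I - {i}. \<psi> j a = 1)"
    and indep': "\<phi> b = -1" "\<And>i. i \<in> I \<Longrightarrow> \<psi> i b = 1"
  obtains q where "squarefree q" "coprime q M" "\<And>p. prime p \<Longrightarrow> p dvd q \<Longrightarrow> \<phi> p = 1"
    "\<And>i. i \<in> I \<Longrightarrow> \<psi> i q = \<epsilon> i"
proof -
  obtain q where q: "q > 0" "coprime q M" "(\<Sum>d | d dvd q. \<phi> d) \<noteq> 0" "\<And>i. i \<in> I \<Longrightarrow> \<psi> i q = \<epsilon> i"
    using prescribed_real_characters[of M \<phi> I \<psi> \<epsilon> b] assms by blast
  define s :: nat where "s = squarefree_part q"
  define r :: nat where "r = square_part q"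
  have qs: "q = s * r\<^sup>2" unfolding s_def r_def by (rule squarefree_decompose)
  have cop: "coprime s M" "coprime r M" using q(2) qs by auto
  have sf: "squarefree s" unfolding s_def by blast
  show thesis
  proof (rule that[OF sf cop(1)])
    show "\<psi> i s = \<epsilon> i" if "i \<in> I" for i
    proof -
      have "\<psi> i q = \<psi> i s * (\<psi> i r * \<psi> i r)"
        unfolding qs power2_eq_square using real_character_mult[OF \<psi>[OF that]] by simp
      then show ?thesis using real_character_coprime[OF \<psi>[OF that] cop(2)] q(4)[OF that] by auto
    qed
    show "\<phi> p = 1" if p: "prime p" "p dvd s" for p
    proof -
      have "odd (multiplicity p q)"
        using prime_multiplicity_squarefree_part[OF p(1), of q] p sf unfolding s_def
        by (metis mod2_eq_if multiplicity_eq_zero_iff not_prime_unit not_squarefree_0)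
      then have "\<phi> p \<noteq> -1" by (intro divisor_sum_nonzero_imp[OF \<phi> q(1,3) p(1)])
      moreover have "coprime p M" by (rule coprime_divisors[OF p(2) dvd_refl cop(1)])
      ultimately show ?thesis using real_character_coprime[OF \<phi>] by blast
    qed
  qed
qed

section \<open>Legendre symbols\<close>

lemma Legendre_cong: "[a = b] (mod int p) \<Longrightarrow> Legendre a (int p) = Legendre b (int p)"
  unfolding Legendre_def QuadRes_def cong_def by simp

lemma Legendre_eq_0_iff: "Legendre a (int p) = 0 \<longleftrightarrow> int p dvd a"
  by (simp add: Legendre_def cong_0_iff)

lemma Legendre_values: "\<not> int p dvd a \<Longrightarrow> Legendre a (int p) = 1 \<or> Legendre a (int p) = -1"
  by (simp add: Legendre_def cong_0_iff)

text \<open>Both numbers lie between -1 and 1, so their difference is too small to be a nonzero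
  multiple of \<open>p\<close>.\<close>

lemma Legendre_eqI:
  assumes "p > 2" "[Legendre a (int p) = x] (mod int p)" "x = 0 \<or> x = 1 \<or> x = -1"
  shows "Legendre a (int p) = x"
proof (rule ccontr)
  assume ne: "Legendre a (int p) \<noteq> x"
  have "int p dvd Legendre a (int p) - x" using assms(2) by (simp add: cong_iff_dvd_diff)
  then have "int p \<le> \<bar>Legendre a (int p) - x\<bar>" 
    using ne dvd_imp_le_int[of "Legendre a (int p) - x" "int p"] by simp
  moreover have "\<bar>Legendre a (int p) - x\<bar> \<le> 2" using assms(3) by (auto simp: Legendre_def)
  ultimately show False using assms(1) by simp
qed

lemma Legendre_mult:
  assumes "prime p" "p > 2"
  shows "Legendre (a * b) (int p) = Legendre a (int p) * Legendre b (int p)"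
proof (rule Legendre_eqI[OF assms(2)])
  let ?h = "(p - 1) div 2"
  have "[Legendre (a * b) (int p) = (a * b) ^ ?h] (mod int p)" by (rule euler_criterion[OF assms])
  moreover have "[Legendre a (int p) * Legendre b (int p) = a ^ ?h * b ^ ?h] (mod int p)"
    by (intro cong_mult euler_criterion assms)
  ultimately show "[Legendre (a * b) (int p) = Legendre a (int p) * Legendre b (int p)] (mod int p)"
    by (metis cong_sym cong_trans power_mult_distrib)
  show "Legendre a (int p) * Legendre b (int p) = 0 \<or> Legendre a (int p) * Legendre b (int p) = 1 \<or>
      Legendre a (int p) * Legendre b (int p) = -1"
    by (auto simp: Legendre_def)
qed

lemma Legendre_1: "prime p \<Longrightarrow> Legendre 1 (int p) = 1"
  unfolding Legendre_def QuadRes_def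
  by (auto simp: cong_0_iff intro!: exI[of _ 1] dest: prime_gt_1_nat)

lemma Legendre_prod:
  assumes "prime p" "p > 2" "finite A"
  shows "Legendre (\<Prod>x\<in>A. f x) (int p) = (\<Prod>x\<in>A. Legendre (f x) (int p))"
  using assms(3) by (induction A rule: finite_induct) (use assms in \<open>simp_all add: Legendre_1 Legendre_mult\<close>)

lemma Legendre_minus_1:
  assumes "prime p" "p > 2"
  shows "Legendre (-1) (int p) = (if p mod 4 = 1 then 1 else -1)"
proof -
  have "odd p" using assms prime_odd_nat by blast
  then have "even ((p - 1) div 2) \<longleftrightarrow> p mod 4 = 1" by presburger
  then have *: "(-1 :: int) ^ ((p - 1) div 2) = (if p mod 4 = 1 then 1 else -1)" by simp
  show ?thesis
    by (rule Legendre_eqI[OF assms(2)]) (use euler_criterion[OF assms, of "-1"] * in auto)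
qed

text \<open>Gauss's lemma for the multiplier 2: with \<open>h = (p - 1) / 2\<close>, the doubles of
  1, ..., \<open>h\<close> that exceed \<open>h\<close> number \<open>h - h div 2\<close>, and the
  parity of this depends on \<open>p\<close> modulo 8.\<close>

lemma Legendre_2:
  assumes p: "prime p" "p > 2"
  shows "Legendre 2 (int p) = (if p mod 8 = 1 \<or> p mod 8 = 7 then 1 else -1)"
proof -
  interpret GAUSS p 2
    by standard (use p in \<open>auto simp: cong_0_iff dest: zdvd_imp_le\<close>)
  define h where "h = (int p - 1) div 2"
  have ph: "int p = 2 * h + 1" unfolding h_def using p_eq2 by simp
  have "E = (\<lambda>x. x * 2) ` {h div 2<..h}"
  proof -
    have "C = (\<lambda>x. x * 2) ` {0<..h}"
      unfolding C_def B_def A_def h_def[symmetric] image_image using ph by (intro image_cong) auto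
    then show ?thesis unfolding E_def h_def[symmetric] by auto
  qed
  then have "card E = nat (h - h div 2)"
    by (simp add: card_image inj_on_def)
  moreover have "h - h div 2 \<ge> 0" using ph by linarith
  then have "even (nat (h - h div 2)) \<longleftrightarrow> even (h - h div 2)" by (simp add: even_nat_iff)
  moreover have "even (h - h div 2) \<longleftrightarrow> int p mod 8 = 1 \<or> int p mod 8 = 7"
    unfolding ph by presburger
  moreover have "int p mod 8 = 1 \<longleftrightarrow> p mod 8 = 1" "int p mod 8 = 7 \<longleftrightarrow> p mod 8 = 7"
    by presburger+
  ultimately show ?thesis using gauss_lemma by simp
qed

text \<open>1 and \<open>p - 1\<close> have the same square, so squaring is not injective on the
  residues modulo \<open>p\<close> and hence not surjective.\<close>

lemma exists_quadratic_nonresidue: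
  assumes "prime p" "p > 2"
  obtains a :: nat where "Legendre (int a) (int p) = -1"
proof -
  let ?f = "\<lambda>x. x\<^sup>2 mod p"
  have "\<not> inj_on ?f {..<p}"
  proof
    assume inj: "inj_on ?f {..<p}"
    have "int (p - 1) ^ 2 = 1 + int p * (int p - 2)"
      using assms by (simp add: of_nat_diff power2_eq_square algebra_simps)
    then have "[int (p - 1) ^ 2 = 1] (mod int p)" by (simp add: cong_def)
    then have "[(p - 1)\<^sup>2 = 1] (mod p)" by (metis cong_int_iff of_nat_1 of_nat_power)
    then have "?f (p - 1) = ?f 1" by (simp add: cong_def)
    then have "p - 1 = 1" using inj_onD[OF inj, of "p - 1" 1] assms by simp
    then show False using assms by simp
  qed
  then have "?f ` {..<p} \<noteq> {..<p}" using finite_surj_inj[of "{..<p}" ?f] by auto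
  moreover have "?f ` {..<p} \<subseteq> {..<p}" using assms by auto
  ultimately obtain a where a: "a < p" "a \<notin> ?f ` {..<p}" by blast
  have "\<not> QuadRes (int p) (int a)"
  proof
    assume "QuadRes (int p) (int a)"
    then obtain y where "[y\<^sup>2 = int a] (mod int p)" unfolding QuadRes_def by blast
    then have "[(y mod int p)\<^sup>2 = int a] (mod int p)" by (simp add: cong_def power_mod)
    moreover define z where "z = nat (y mod int p)"
    ultimately have "[int (z\<^sup>2) = int a] (mod int p)" using assms by simp
    then have "?f z = a" using a(1) unfolding cong_int_iff by (simp add: cong_def)
    moreover have "z < p" unfolding z_def using assms by (simp add: nat_less_iff)
    ultimately show False using a(2) by auto
  qed
  moreover have "a \<noteq> 0"
  proof
    assume "a = 0"
    then have "a = ?f 0" by simp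
    then show False using a(2) assms by (metis imageI lessThan_iff prime_gt_0_nat)
  qed
  then have "\<not> int p dvd int a" using a(1) by (auto dest: dvd_imp_le)
  ultimately show thesis
    by (intro that[of a]) (auto simp: Legendre_def cong_0_iff)
qed

text \<open>The Chinese remainder theorem, one prime at a time; squarefreeness makes the prime
  coprime to its cofactor.\<close>

lemma square_root_mod_squarefree:
  fixes n :: nat and c :: int
  assumes "squarefree n" "\<And>p. prime p \<Longrightarrow> p dvd n \<Longrightarrow> \<exists>y. int p dvd y\<^sup>2 - c"
  shows "\<exists>y. int n dvd y\<^sup>2 - c"
  using assms
proof (induction n rule: less_induct)
  case (less n)
  have n0: "n > 0" using less.prems(1) by (auto intro: gr0I)
  show ?case
  proof (cases "n = 1")
    case False
    then obtain p where p: "prime p" "p dvd n" using prime_factor_nat by blast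
    then obtain m where m: "n = p * m" by blast
    have sm: "squarefree m" using less.prems(1) unfolding m by (rule squarefree_multD(2))
    have "\<not> p dvd m"
    proof
      assume "p dvd m"
      then have "p\<^sup>2 dvd n" unfolding m power2_eq_square by simp
      then show False using squarefreeD[OF less.prems(1)] p(1) not_prime_unit by blast
    qed
    then have cop: "coprime p m" by (rule prime_imp_coprime[OF p(1)])
    have "m < n" using m n0 prime_gt_1_nat[OF p(1)] by simp
    then obtain y where y: "int m dvd y\<^sup>2 - c"
      using less.IH[OF _ sm] less.prems(2) m by (meson dvd_mult)
    obtain x where x: "int p dvd x\<^sup>2 - c" using less.prems(2) p by blast
    have "coprime (int p) (int m)" using cop by simp
    then obtain z where z: "[z = x] (mod int p)" "[z = y] (mod int m)"
      using binary_chinese_remainder_int by blast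
    have "[z\<^sup>2 - c = x\<^sup>2 - c] (mod int p)" "[z\<^sup>2 - c = y\<^sup>2 - c] (mod int m)"
      using z by (auto intro!: cong_diff cong_pow)
    then have "int p dvd z\<^sup>2 - c" "int m dvd z\<^sup>2 - c" using x y by (auto simp: cong_dvd_iff)
    then have "int p * int m dvd z\<^sup>2 - c" using cop by (intro divides_mult) auto
    then show ?thesis unfolding m by auto
  qed auto
qed

lemma Legendre_eq_1_imp_square: "Legendre c (int p) = 1 \<Longrightarrow> \<exists>y. int p dvd y\<^sup>2 - c"
  unfolding Legendre_def QuadRes_def by (auto simp: cong_iff_dvd_diff split: if_splits)

lemma odd_mod_8_cases: "odd (a::nat) \<Longrightarrow> a mod 8 = 1 \<or> a mod 8 = 3 \<or> a mod 8 = 5 \<or> a mod 8 = 7"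
  by presburger

section \<open>Legendre symbols as characters with a common modulus\<close>

text \<open>Vanishing off the units modulo \<open>M\<close>, not merely modulo \<open>p\<close>,
  gives the symbols for different primes the same modulus.\<close>

definition Legendre_char :: "nat \<Rightarrow> nat \<Rightarrow> nat \<Rightarrow> real" where
  "Legendre_char M p a = (if coprime a M then real_of_int (Legendre (int a) (int p)) else 0)"

text \<open>Intended for a subgroup \<open>R\<close> of index 1 or 2 in the units modulo 8, which
  becomes the kernel; the full group yields the principal character.\<close>

definition mod_8_char :: "nat \<Rightarrow> nat set \<Rightarrow> nat \<Rightarrow> real" where
  "mod_8_char M R a = (if coprime a M then if a mod 8 \<in> R then 1 else -1 else 0)"

lemma coprime_add_self_iff: "coprime (a + M) M \<longleftrightarrow> coprime a (M::nat)"
  by (metis coprime_iff_gcd_eq_1 gcd_add1)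

lemma real_character_Legendre_char:
  assumes p: "prime p" "p > 2" "p dvd M"
  shows "real_character M (Legendre_char M p)"
  unfolding real_character_def
proof (intro conjI allI)
  fix a b
  show "Legendre_char M p (a * b) = Legendre_char M p a * Legendre_char M p b"
    by (simp add: Legendre_char_def Legendre_mult[OF p(1,2)])
  have "[int (a + M) = int a] (mod int p)" using p(3) by (simp add: cong_iff_dvd_diff)
  then show "Legendre_char M p (a + M) = Legendre_char M p a"
    using Legendre_cong by (simp add: Legendre_char_def coprime_add_self_iff)
  show "Legendre_char M p a = (if coprime a M then 1 else 0) \<or>
      Legendre_char M p a = (if coprime a M then - 1 else 0)"
  proof (cases "coprime a M")
    case True
    then have "\<not> p dvd a" using p by (meson coprime_common_divisor not_prime_unit)
    then show ?thesis using Legendre_values[of p "int a"] True by (auto simp: Legendre_char_def)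
  qed (simp add: Legendre_char_def)
qed

lemma real_character_mod_8_char:
  assumes "8 dvd M" and R: "R = {1,3} \<or> R = {1,5} \<or> R = {1,7} \<or> R = {1,3,5,7}"
  shows "real_character M (mod_8_char M R)"
  unfolding real_character_def
proof (intro conjI allI)
  fix a b
  have M2: "even M" using assms(1) by (meson dvd_trans even_numeral)
  have odd: "odd a" if "coprime a M" for a
    using that M2 by (metis coprime_common_divisor odd_one)
  show "mod_8_char M R (a * b) = mod_8_char M R a * mod_8_char M R b"
  proof (cases "coprime a M \<and> coprime b M")
    case True
    define i j where "i = a mod 8" and "j = b mod 8"
    have ab: "a * b mod 8 = i * j mod 8" unfolding i_def j_def by (simp add: mod_mult_eq)
    have "i = 1 \<or> i = 3 \<or> i = 5 \<or> i = 7" "j = 1 \<or> j = 3 \<or> j = 5 \<or> j = 7"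
      unfolding i_def j_def using odd_mod_8_cases True odd by blast+
    then have "(if i * j mod 8 \<in> R then 1 else -1) = (if i \<in> R then 1 else -1) * (if j \<in> R then 1 else (-1::real))"
      using R by (elim disjE) simp_all
    then show ?thesis using True by (simp add: mod_8_char_def ab i_def j_def)
  qed (auto simp: mod_8_char_def)
  have "(a + M) mod 8 = a mod 8" using assms(1) by auto
  then show "mod_8_char M R (a + M) = mod_8_char M R a"
    by (simp add: mod_8_char_def coprime_add_self_iff)
qed (auto simp: mod_8_char_def)

definition odd_primes_of :: "nat \<Rightarrow> nat set" where
  "odd_primes_of n = {p. prime p \<and> p dvd n \<and> p \<noteq> 2}"

lemma odd_primes_ofD:
  assumes "p \<in> odd_primes_of n"
  shows "prime p" "p > 2" "p dvd n" "odd p"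
  using assms prime_ge_2_nat[of p] prime_odd_nat[of p] unfolding odd_primes_of_def by auto

lemma finite_odd_primes_of: "n > 0 \<Longrightarrow> finite (odd_primes_of n)"
  unfolding odd_primes_of_def by (rule finite_subset[of _ "{..n}"]) (auto dest: dvd_imp_le)

lemma squarefree_eq_prod_odd_primes:
  assumes "squarefree n"
  shows "n = (if even n then 2 else 1) * \<Prod>(odd_primes_of n)"
proof -
  have n0: "n > 0" using assms by (auto intro: gr0I)
  have mult: "multiplicity p n = 1" if "p \<in> prime_factors n" for p
    using assms that squarefree_factorial_semiring'[of n] n0 by auto
  have "n = (\<Prod>p\<in>prime_factors n. p ^ multiplicity p n)"
    by (rule prime_factorization_nat[OF n0])
  also have "\<dots> = \<Prod>(prime_factors n)" using mult by (intro prod.cong) auto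
  also have "prime_factors n = (if even n then {2} else {}) \<union> odd_primes_of n"
    using n0 by (auto simp: odd_primes_of_def prime_factors_dvd)
  also have "\<Prod>\<dots> = (if even n then 2 else 1) * \<Prod>(odd_primes_of n)"
    using finite_odd_primes_of[OF n0] by (auto simp: odd_primes_of_def)
  finally show ?thesis .
qed

lemma odd_prod_odd_primes: "n > 0 \<Longrightarrow> odd (\<Prod>(odd_primes_of n))"
  using finite_odd_primes_of[of n] odd_primes_ofD(4)[of _ n]
  by (simp add: even_prod_iff)

text \<open>Lets a sign that depends on residues modulo 4 or 8 be read off from the product of the
  primes rather than prime by prime.\<close>

lemma prod_odd_multiplicative:
  fixes f :: "nat \<Rightarrow> int"
  assumes "finite A" "\<And>a. a \<in> A \<Longrightarrow> odd a" "f 1 = 1"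
    and "\<And>a b. odd a \<Longrightarrow> odd b \<Longrightarrow> f (a * b) = f a * f b"
  shows "(\<Prod>a\<in>A. f a) = f (\<Prod>A)"
  using assms(1,2)
proof (induction A rule: finite_induct)
  case (insert a A)
  have "odd (\<Prod>A)" using insert by (simp add: even_prod_iff)
  then show ?case using insert assms(4) by simp
qed (use assms(3) in simp)

text \<open>For squarefree \<open>n\<close>, the classes modulo 8 of a prime \<open>l\<close> for
  which the signs from the reciprocity law and its two supplements cancel in the symbol of
  \<open>-n\<close> modulo \<open>l\<close>.\<close>

definition reciprocity_residues :: "nat \<Rightarrow> nat set" where
  "reciprocity_residues n =
     (if even n then if n div 2 mod 4 = 1 then {1,3} else {1,7}
      else if n mod 4 = 1 then {1,5} else {1,3,5,7})"

text \<open>Quadratic reciprocity at every odd prime factor of \<open>n\<close>, together with the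
  supplements for -1 and 2. It exhibits the symbol of \<open>-n\<close> modulo \<open>l\<close> as
  the value at \<open>l\<close> of a character modulo \<open>8 * n\<close>.\<close>

lemma Legendre_minus_eq_prod:
  assumes n: "squarefree n" and l: "prime l" "l > 2" "\<not> l dvd n"
  shows "Legendre (- int n) (int l) =
    (if l mod 8 \<in> reciprocity_residues n then 1 else -1) * (\<Prod>p\<in>odd_primes_of n. Legendre (int l) (int p))"
proof -
  let ?P = "odd_primes_of n" and ?m = "\<Prod>(odd_primes_of n)"
  \<comment> \<open>The sign in the reciprocity law for \<open>p\<close> and
    \<open>l\<close>.\<close>
  define \<sigma> :: "nat \<Rightarrow> int" where "\<sigma> p = (if l mod 4 = 3 \<and> p mod 4 = 3 then -1 else 1)" for p
  have n0: "n > 0" using n by (auto intro: gr0I)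
  have fin: "finite ?P" by (rule finite_odd_primes_of[OF n0])
  have lodd: "odd l" using l prime_odd_nat by blast
  have modd: "odd ?m" using odd_prod_odd_primes[OF n0] .
  have recip: "Legendre (int p) (int l) = \<sigma> p * Legendre (int l) (int p)" if p: "p \<in> ?P" for p
  proof -
    note p' = odd_primes_ofD[OF p]
    have ne: "p \<noteq> l" using p'(3) l(3) by blast
    have QR: "Legendre (int p) (int l) * Legendre (int l) (int p) = (-1) ^ ((p - 1) div 2 * ((l - 1) div 2))"
      using Quadratic_Reciprocity p' l ne by blast
    have "(p - 1) div 2 * ((l - 1) div 2) mod 2 = (if l mod 4 = 3 \<and> p mod 4 = 3 then 1 else 0)"
    proof -
      have "odd ((p - 1) div 2) \<longleftrightarrow> p mod 4 = 3" "odd ((l - 1) div 2) \<longleftrightarrow> l mod 4 = 3"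
        using p'(4) lodd by presburger+
      then show ?thesis by (auto simp: mod2_eq_if)
    qed
    then have "even ((p - 1) div 2 * ((l - 1) div 2)) \<longleftrightarrow> \<not> (l mod 4 = 3 \<and> p mod 4 = 3)"
      by (simp only: even_iff_mod_2_eq_zero split: if_splits) auto
    then have s: "(-1) ^ ((p - 1) div 2 * ((l - 1) div 2)) = \<sigma> p" unfolding \<sigma>_def by auto
    have "\<not> p dvd l" using ne primes_dvd_imp_eq[OF p'(1) l(1)] by blast
    then have "Legendre (int l) (int p) * Legendre (int l) (int p) = 1"
      using Legendre_values[of p "int l"] by auto
    then show ?thesis using QR s by (metis mult.assoc mult.right_neutral)
  qed
  have \<sigma>: "(\<Prod>p\<in>?P. \<sigma> p) = \<sigma> ?m"
  proof (rule prod_odd_multiplicative[OF fin odd_primes_ofD(4)])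
    fix a b :: nat assume ab: "odd a" "odd b"
    define i j where "i = a mod 4" and "j = b mod 4"
    have "a * b mod 4 = i * j mod 4" unfolding i_def j_def by (simp add: mod_mult_eq)
    moreover have "i = 1 \<or> i = 3" "j = 1 \<or> j = 3" unfolding i_def j_def using ab by presburger+
    ultimately show "\<sigma> (a * b) = \<sigma> a * \<sigma> b" unfolding \<sigma>_def i_def[symmetric] j_def[symmetric] by auto
  qed (auto simp: \<sigma>_def)
  have "- int n = (-1) * ((if even n then 2 else 1) * int ?m)"
    by (subst squarefree_eq_prod_odd_primes[OF n]) simp
  also have "int ?m = (\<Prod>p\<in>?P. int p)" by simp
  finally have "Legendre (- int n) (int l) = Legendre (-1) (int l) *
      (Legendre (if even n then 2 else 1) (int l) * (\<Prod>p\<in>?P. Legendre (int p) (int l)))"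
    by (simp only: Legendre_mult[OF l(1,2)] Legendre_prod[OF l(1,2) fin])
  also have "(\<Prod>p\<in>?P. Legendre (int p) (int l)) = \<sigma> ?m * (\<Prod>p\<in>?P. Legendre (int l) (int p))"
    using recip \<sigma> by (simp add: prod.distrib)
  finally have main: "Legendre (- int n) (int l) = (Legendre (-1) (int l) *
      Legendre (if even n then 2 else 1) (int l) * \<sigma> ?m) * (\<Prod>p\<in>?P. Legendre (int l) (int p))"
    by (simp only: mult.assoc)
  have m: "?m = (if even n then n div 2 else n)"
    using squarefree_eq_prod_odd_primes[OF n] by (auto split: if_splits)
  have m4: "?m mod 4 = 1 \<or> ?m mod 4 = 3" using modd by presburger
  have l8: "l mod 8 = 1 \<or> l mod 8 = 3 \<or> l mod 8 = 5 \<or> l mod 8 = 7" by (rule odd_mod_8_cases[OF lodd])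
  have l4: "l mod 4 = l mod 8 mod 4" by (simp add: mod_mod_cancel)
  have "Legendre (-1) (int l) * Legendre (if even n then 2 else 1) (int l) * \<sigma> ?m =
      (if l mod 8 \<in> reciprocity_residues n then 1 else -1)"
    using l8 m4 m unfolding Legendre_minus_1[OF l(1,2)] \<sigma>_def reciprocity_residues_def l4
    by (cases "even n") (auto simp: Legendre_2[OF l(1,2)] Legendre_1[OF l(1)])
  then show ?thesis using main by simp
qed

lemma odd_primes_chinese_remainder:
  fixes u :: "nat \<Rightarrow> nat"
  assumes "finite P" "\<And>p. p \<in> P \<Longrightarrow> prime p \<and> p > 2"
  shows "\<exists>x. [x = c] (mod 8) \<and> (\<forall>p\<in>P. [x = u p] (mod p))"
proof -
  have c8: "coprime p 8" if "p \<in> P" for p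
  proof -
    have "coprime p (2 ^ 3)" using assms(2)[OF that] prime_odd_nat[of p] by (simp only: coprime_power_right_iff) simp
    then show ?thesis by simp
  qed
  have "8 \<notin> P" using assms(2) c8 by fastforce
  have "\<exists>x. \<forall>i\<in>insert 8 P. [x = (if i = 8 then c else u i)] (mod i)"
  proof (rule chinese_remainder_nat)
    show "\<forall>i\<in>insert 8 P. \<forall>j\<in>insert 8 P. i \<noteq> j \<longrightarrow> coprime i j"
      using c8 assms(2) by (auto simp: primes_coprime coprime_commute)
  qed (use assms(1) in auto)
  then show ?thesis using \<open>8 \<notin> P\<close> by (metis insert_iff)
qed

lemma coprime_8_mult_squarefree:
  assumes "n > 0" "odd x" "\<And>p. p \<in> odd_primes_of n \<Longrightarrow> \<not> p dvd x"
  shows "coprime x (8 * n)"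
proof (rule ccontr)
  assume "\<not> coprime x (8 * n)"
  then have "gcd x (8 * n) \<noteq> 1" using coprime_iff_gcd_eq_1 by blast
  then obtain p where "prime p" "p dvd gcd x (8 * n)" using prime_factor_nat by blast
  then have p: "prime p" "p dvd x" "p dvd 8 * n" by auto
  have "p \<noteq> 2" using p(2) assms(2) by auto
  then have "\<not> p dvd 2 ^ 3" using p(1) by (metis primes_dvd_imp_eq prime_dvd_power two_is_prime_nat)
  then have "p dvd n" using p(1,3) prime_dvd_mult_iff[of p 8 n] by simp
  then show False using assms(3) p \<open>p \<noteq> 2\<close> unfolding odd_primes_of_def by blast
qed

lemma exists_coprime_with_Legendre:
  fixes u :: "nat \<Rightarrow> nat"
  assumes n: "n > 0" and c: "odd c" and u: "\<And>p. p \<in> odd_primes_of n \<Longrightarrow> \<not> p dvd u p"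
  obtains x where "coprime x (8 * n)" "x mod 8 = c mod 8"
    "\<And>p. p \<in> odd_primes_of n \<Longrightarrow> Legendre (int x) (int p) = Legendre (int (u p)) (int p)"
proof -
  obtain x where x: "[x = c] (mod 8)" "\<And>p. p \<in> odd_primes_of n \<Longrightarrow> [x = u p] (mod p)"
    using odd_primes_chinese_remainder[OF finite_odd_primes_of[OF n]] odd_primes_ofD by metis
  have x8: "x mod 8 = c mod 8" using x(1) by (simp add: cong_def)
  then have "odd x" using c by presburger
  moreover have "\<not> p dvd x" if "p \<in> odd_primes_of n" for p
    using x(2)[OF that] u[OF that] by (simp add: cong_dvd_iff)
  ultimately have "coprime x (8 * n)" by (rule coprime_8_mult_squarefree[OF n])
  moreover have "Legendre (int x) (int p) = Legendre (int (u p)) (int p)" if "p \<in> odd_primes_of n" for p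
    using x(2)[OF that] by (intro Legendre_cong) (simp add: cong_int_iff)
  ultimately show thesis using x8 that by blast
qed

lemma real_character_eq_1_of_primes:
  assumes \<phi>: "real_character M \<phi>" and "q > 0" "\<And>p. prime p \<Longrightarrow> p dvd q \<Longrightarrow> \<phi> p = 1"
  shows "\<phi> q = 1"
  using assms(2,3)
proof (induction q rule: less_induct)
  case (less q)
  show ?case
  proof (cases "q = 1")
    case True
    then show ?thesis using real_character_1[OF \<phi>] by simp
  next
    case False
    then obtain p where p: "prime p" "p dvd q" using prime_factor_nat by blast
    then obtain m where m: "q = p * m" by blast
    have "m < q" "m > 0" using m less.prems(1) prime_gt_1_nat[OF p(1)] by auto
    then have "\<phi> m = 1" using less.IH less.prems(2) m by simp
    then show ?thesis using m less.prems(2) p real_character_mult[OF \<phi>] by simp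
  qed
qed

text \<open>-2 is a residue exactly for the primes in the classes 1 and 3 modulo 8. These classes
  form a subgroup, and it contains the class of \<open>n\<close>.\<close>

lemma minus_2_residue_prod:
  assumes "squarefree n" "n mod 8 = 3"
  shows "(\<Prod>p\<in>odd_primes_of n. Legendre (-2) (int p)) = 1"
proof -
  define \<tau> :: "nat \<Rightarrow> int" where "\<tau> p = (if p mod 8 = 1 \<or> p mod 8 = 3 then 1 else -1)" for p
  have n0: "n > 0" using assms(2) by (auto intro: gr0I)
  have "Legendre (-2) (int p) = \<tau> p" if p: "p \<in> odd_primes_of n" for p
  proof -
    note p' = odd_primes_ofD[OF p]
    have "Legendre (-2) (int p) = Legendre (-1) (int p) * Legendre 2 (int p)"
      using Legendre_mult[OF p'(1,2), of "-1" 2] by simp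
    moreover have "p mod 4 = p mod 8 mod 4" by (simp add: mod_mod_cancel)
    ultimately show ?thesis
      using odd_mod_8_cases[OF p'(4)] unfolding Legendre_minus_1[OF p'(1,2)] Legendre_2[OF p'(1,2)] \<tau>_def
      by auto
  qed
  then have "(\<Prod>p\<in>odd_primes_of n. Legendre (-2) (int p)) = (\<Prod>p\<in>odd_primes_of n. \<tau> p)" by simp
  also have "\<dots> = \<tau> (\<Prod>(odd_primes_of n))"
  proof (rule prod_odd_multiplicative[OF finite_odd_primes_of[OF n0] odd_primes_ofD(4)])
    fix a b :: nat assume ab: "odd a" "odd b"
    define i j where "i = a mod 8" and "j = b mod 8"
    have "a * b mod 8 = i * j mod 8" unfolding i_def j_def by (simp add: mod_mult_eq)
    moreover have "i = 1 \<or> i = 3 \<or> i = 5 \<or> i = 7" "j = 1 \<or> j = 3 \<or> j = 5 \<or> j = 7"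
      unfolding i_def j_def using odd_mod_8_cases ab by blast+
    ultimately show "\<tau> (a * b) = \<tau> a * \<tau> b" unfolding \<tau>_def i_def[symmetric] j_def[symmetric]
      by (elim disjE) simp_all
  qed (auto simp: \<tau>_def)
  also have "odd n" using assms(2) by presburger
  then have "\<Prod>(odd_primes_of n) = n" using squarefree_eq_prod_odd_primes[OF assms(1)] by simp
  finally show ?thesis using assms(2) by (simp add: \<tau>_def)
qed

text \<open>Prescribing the symbols of \<open>q\<close> modulo the odd primes of \<open>n\<close>
  makes \<open>-Q\<close> a square modulo \<open>n\<close>, while \<open>\<phi> l = 1\<close> for
  the primes \<open>l\<close> of \<open>q\<close> makes \<open>-n\<close> a square modulo
  \<open>q\<close>. For \<open>n mod 8 = 3\<close> the character \<open>\<phi>\<close> is the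
  product of all these symbols; this dictates one of them, and \<open>Q = 2 * q\<close> is taken
  instead of \<open>q\<close>.\<close>

lemma exists_mutual_residue:
  assumes n: "squarefree n" and cl: "n mod 4 = 1 \<or> n mod 4 = 2 \<or> n mod 8 = 3"
  obtains Q :: nat where "squarefree Q" "coprime n Q" "\<exists>s. int Q dvd s\<^sup>2 + int n" "\<exists>r. int n dvd r\<^sup>2 + int Q"
proof -
  define M where "M = 8 * n"
  define P where "P = odd_primes_of n"
  define R where "R = reciprocity_residues n"
  define \<psi> where "\<psi> = Legendre_char M"
  define \<phi> where "\<phi> a = mod_8_char M R a * ((if coprime a M then 1 else 0) * (\<Prod>p\<in>P. \<psi> p a))" for a
  have n0: "n > 0" using n by (auto intro: gr0I)
  have M1: "M > 1" using n0 by (simp add: M_def)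
  have "even M" by (simp add: M_def)
  then have odd_of_coprime: "odd a" if "coprime a M" for a
    using that by (metis coprime_common_divisor odd_one)
  have finP: "finite P" unfolding P_def by (rule finite_odd_primes_of[OF n0])
  have \<psi>: "real_character M (\<psi> p)" if "p \<in> P" for p
    unfolding \<psi>_def using odd_primes_ofD[of p n] that
    by (intro real_character_Legendre_char) (auto simp: P_def M_def)
  have \<psi>_eq: "\<psi> p a = real_of_int (Legendre (int a) (int p))" if "coprime a M" for p a
    using that by (simp add: \<psi>_def Legendre_char_def)
  have \<phi>_eq: "\<phi> a = (if a mod 8 \<in> R then 1 else -1) * (\<Prod>p\<in>P. real_of_int (Legendre (int a) (int p)))"
    if "coprime a M" for a
    using that \<psi>_eq by (simp add: \<phi>_def mod_8_char_def)
  have \<phi>: "real_character M \<phi>"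
    unfolding \<phi>_def using finP \<psi>
    by (intro real_character_times real_character_prod real_character_mod_8_char)
       (auto simp: R_def reciprocity_residues_def M_def)
  have res: "\<exists>s. int l dvd s\<^sup>2 - (- int n)" if l: "prime l" "coprime l M" "\<phi> l = 1" for l
  proof -
    have "l \<noteq> 2" using l(2) by (auto simp: M_def)
    then have l2: "l > 2" using prime_ge_2_nat[OF l(1)] by simp
    have ndvd: "\<not> l dvd n"
      using l(1,2) by (metis M_def coprime_common_divisor dvd_mult dvd_refl not_prime_unit)
    have "real_of_int (Legendre (- int n) (int l)) = 1"
      using l(3) unfolding \<phi>_eq[OF l(2)] Legendre_minus_eq_prod[OF n l(1) l2 ndvd] R_def P_def by (auto split: if_splits)
    then show ?thesis by (intro Legendre_eq_1_imp_square) simp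
  qed
  have nonres: "\<exists>x. coprime x M \<and> x mod 8 = 1 \<and> Legendre (int x) (int p) = -1 \<and>
      (\<forall>p'\<in>P - {p}. Legendre (int x) (int p') = 1)" if p: "p \<in> P" for p
  proof -
    note p' = odd_primes_ofD[OF p[unfolded P_def]]
    obtain a where a: "Legendre (int a) (int p) = -1" using exists_quadratic_nonresidue[OF p'(1,2)] .
    have nd: "\<not> int p dvd int a" using a Legendre_eq_0_iff[of "int a" p] by simp
    define u where "u p' = (if p' = p then a else 1)" for p'
    have "\<not> p' dvd u p'" if "p' \<in> odd_primes_of n" for p'
    proof (cases "p' = p")
      case True
      then show ?thesis using nd by (simp add: u_def)
    next
      case False
      then show ?thesis using odd_primes_ofD(2)[OF that] by (simp add: u_def)
    qed
    then obtain x where x: "coprime x (8 * n)" "x mod 8 = 1 mod 8"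
        "\<And>p'. p' \<in> odd_primes_of n \<Longrightarrow> Legendre (int x) (int p') = Legendre (int (u p')) (int p')"
      using exists_coprime_with_Legendre[OF n0 odd_one, of u] by blast
    have "Legendre (int x) (int p') = 1" if "p' \<in> P - {p}" for p'
      using x(3)[of p'] that Legendre_1[OF odd_primes_ofD(1)[of p' n]] by (simp add: u_def P_def)
    moreover have "Legendre (int x) (int p) = -1" using x(3)[of p] p a by (simp add: u_def P_def)
    ultimately show ?thesis using x(1,2) unfolding M_def by (intro exI[of _ x]) simp
  qed
  show thesis
  proof (cases "n mod 8 = 3")
    case False
    then have cl': "n mod 4 = 1 \<or> even n" using cl by presburger
    \<comment> \<open>A class modulo 8 outside \<open>R\<close>. As all Legendre symbols of
      \<open>b\<close> are 1, it makes \<open>\<phi> b = -1\<close> and so separates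
      \<open>\<phi>\<close> from the \<open>\<psi> p\<close>.\<close>
    define c :: nat where "c = (if even n then 5 else 3)"
    obtain b where b: "coprime b M" "b mod 8 = c mod 8" "\<And>p. p \<in> P \<Longrightarrow> Legendre (int b) (int p) = Legendre 1 (int p)"
    proof (rule exists_coprime_with_Legendre[OF n0, of c "\<lambda>_. 1"])
      show "odd c" by (simp add: c_def)
      show "\<not> p dvd 1" if "p \<in> odd_primes_of n" for p using odd_primes_ofD(2)[OF that] by simp
    qed (auto simp: P_def M_def)
    have b1: "Legendre (int b) (int p) = 1" if "p \<in> P" for p
      using b(3)[OF that] Legendre_1 odd_primes_ofD(1) that unfolding P_def by simp
    have "c mod 8 \<notin> R" using cl' by (auto simp: c_def R_def reciprocity_residues_def)
    then have \<phi>b: "\<phi> b = -1" using b1 b(2) by (simp add: \<phi>_eq[OF b(1)])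
    define \<epsilon> where "\<epsilon> p = real_of_int (Legendre (-1) (int p))" for p :: nat
    obtain q where q: "squarefree q" "coprime q M" "\<And>l. prime l \<Longrightarrow> l dvd q \<Longrightarrow> \<phi> l = 1"
        "\<And>p. p \<in> P \<Longrightarrow> \<psi> p q = \<epsilon> p"
    proof (rule prescribed_real_characters_squarefree[OF M1 \<phi> finP \<psi>])
      show "\<epsilon> p = 1 \<or> \<epsilon> p = -1" if "p \<in> P" for p
        using odd_primes_ofD[of p n] that unfolding P_def \<epsilon>_def by (simp add: Legendre_minus_1)
      show "\<exists>a. \<psi> p a = -1 \<and> (\<forall>j\<in>P - {p}. \<psi> j a = 1)" if "p \<in> P" for p
        using nonres[OF that] \<psi>_eq by (metis of_int_1 of_int_minus)
      show "\<phi> b = -1" by (rule \<phi>b)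
      show "\<psi> p b = 1" if "p \<in> P" for p using b1[OF that] \<psi>_eq[OF b(1)] by simp
    qed auto
    have "\<exists>s. int q dvd s\<^sup>2 - (- int n)"
      using q(1)
    proof (rule square_root_mod_squarefree)
      fix l assume l: "prime l" "l dvd q"
      then have "coprime l M" using coprime_divisors[OF l(2) dvd_refl q(2)] by simp
      then show "\<exists>s. int l dvd s\<^sup>2 - (- int n)" using res q(3) l by blast
    qed
    moreover have "\<exists>r. int n dvd r\<^sup>2 - (- int q)"
      using n
    proof (rule square_root_mod_squarefree)
      fix p assume p: "prime p" "p dvd n"
      show "\<exists>r. int p dvd r\<^sup>2 - (- int q)"
      proof (cases "p = 2")
        case True
        then show ?thesis by (intro exI[of _ "int q"]) simp
      next
        case False
        then have pP: "p \<in> P" using p by (simp add: P_def odd_primes_of_def)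
        note p' = odd_primes_ofD[OF pP[unfolded P_def]]
        have "Legendre (int q) (int p) = Legendre (-1) (int p)"
          using q(4)[OF pP] \<psi>_eq[OF q(2)] unfolding \<epsilon>_def by simp
        then have "Legendre (- int q) (int p) = 1"
          using Legendre_mult[OF p'(1,2), of "-1" "int q"] by (simp add: Legendre_minus_1[OF p'(1,2)] split: if_splits)
        then show ?thesis by (rule Legendre_eq_1_imp_square)
      qed
    qed
    moreover have "coprime n q" using q(2) by (simp add: M_def coprime_commute)
    ultimately show thesis using that[of q] q(1) by simp
  next
    case True
    then have oddn: "odd n" by presburger
    have R: "R = {1,3,5,7}"
    proof -
      have "n mod 4 \<noteq> 1" using True by presburger
      then show ?thesis using oddn by (simp add: R_def reciprocity_residues_def)
    qed
    have \<phi>_eq': "\<phi> a = (\<Prod>p\<in>P. real_of_int (Legendre (int a) (int p)))" if "coprime a M" for a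
    proof -
      show ?thesis
        using \<phi>_eq[OF that] odd_mod_8_cases[OF odd_of_coprime[OF that]] unfolding R by auto
    qed
    have "n = \<Prod>P"
      using squarefree_eq_prod_odd_primes[OF n] unfolding if_not_P[OF oddn] mult_1 P_def .
    moreover have "n \<noteq> 1" using True by auto
    ultimately have "P \<noteq> {}" by auto
    then obtain p0 where p0: "p0 \<in> P" by blast
    \<comment> \<open>Here \<open>\<phi>\<close> is the product of all symbols, so one prime is set
      aside to keep the characters independent; its symbol is recovered below from
      \<open>\<phi> q = 1\<close>.\<close>
    define I where "I = P - {p0}"
    have IP: "p \<in> P" if "p \<in> I" for p using that I_def by blast
    have finI: "finite I" using finP I_def by simp
    obtain b where b: "coprime b M" "Legendre (int b) (int p0) = -1"
        "\<And>p. p \<in> I \<Longrightarrow> Legendre (int b) (int p) = 1"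
      using nonres[OF p0] unfolding I_def by blast
    have \<phi>b: "\<phi> b = -1"
      unfolding \<phi>_eq'[OF b(1)] prod.remove[OF finP p0] I_def[symmetric] using b by simp
    \<comment> \<open>The symbols of -1 would multiply to -1 because \<open>n mod 4 = 3\<close>,
      contradicting \<open>\<phi> q = 1\<close>. Those of -2 multiply to 1, and the factor 2 in
      \<open>Q\<close> compensates for the change.\<close>
    define \<epsilon> where "\<epsilon> p = real_of_int (Legendre (-2) (int p))" for p :: nat
    have L2: "Legendre (-2) (int p) = 1 \<or> Legendre (-2) (int p) = -1" if "p \<in> P" for p
      using odd_primes_ofD[of p n] that unfolding P_def by (intro Legendre_values) (auto dest: zdvd_imp_le)
    then have \<epsilon>: "\<epsilon> p = 1 \<or> \<epsilon> p = -1" if "p \<in> P" for p using that unfolding \<epsilon>_def by fastforce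
    obtain q where q: "squarefree q" "coprime q M" "\<And>l. prime l \<Longrightarrow> l dvd q \<Longrightarrow> \<phi> l = 1"
        "\<And>p. p \<in> I \<Longrightarrow> \<psi> p q = \<epsilon> p"
    proof (rule prescribed_real_characters_squarefree[OF M1 \<phi> finI \<psi>[OF IP]])
      show "\<epsilon> p = 1 \<or> \<epsilon> p = -1" if "p \<in> I" for p using \<epsilon>[OF IP[OF that]] .
      show "\<exists>a. \<psi> p a = -1 \<and> (\<forall>j\<in>I - {p}. \<psi> j a = 1)" if "p \<in> I" for p
        using nonres[OF IP[OF that]] \<psi>_eq IP by (metis DiffD1 DiffD2 DiffI of_int_1 of_int_minus)
      show "\<phi> b = -1" by (rule \<phi>b)
      show "\<psi> p b = 1" if "p \<in> I" for p using b(3)[OF that] \<psi>_eq[OF b(1)] by simp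
    qed auto
    have q0: "q > 0" using q(1) by (auto intro: gr0I)
    have "\<phi> q = 1" by (rule real_character_eq_1_of_primes[OF \<phi> q0 q(3)])
    then have "(\<Prod>p\<in>P. real_of_int (Legendre (int q) (int p))) = 1" by (simp add: \<phi>_eq'[OF q(2)])
    moreover have "(\<Prod>p\<in>P. \<epsilon> p) = 1"
      using minus_2_residue_prod[OF n True] unfolding \<epsilon>_def P_def by (simp flip: of_int_prod)
    moreover have "(\<Prod>p\<in>I. real_of_int (Legendre (int q) (int p))) = (\<Prod>p\<in>I. \<epsilon> p)"
      using q(4) \<psi>_eq[OF q(2)] by (intro prod.cong) auto
    moreover have "(\<Prod>p\<in>I. \<epsilon> p) \<noteq> 0" using \<epsilon> IP finI by fastforce
    ultimately have "real_of_int (Legendre (int q) (int p0)) = \<epsilon> p0"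
      unfolding prod.remove[OF finP p0] I_def[symmetric] by (metis mult_right_cancel)
    then have qP: "Legendre (int q) (int p) = Legendre (-2) (int p)" if "p \<in> P" for p
      using that q(4) \<psi>_eq[OF q(2)] unfolding \<epsilon>_def I_def by (cases "p = p0") auto
    have q2: "odd q" by (rule odd_of_coprime[OF q(2)])
    then have sf: "squarefree (2 * q)"
      using q(1) by (intro squarefree_mult_coprime) (auto intro: squarefree_prime)
    have "\<exists>s. int (2 * q) dvd s\<^sup>2 - (- int n)"
      using sf
    proof (rule square_root_mod_squarefree)
      fix l assume l: "prime l" "l dvd 2 * q"
      show "\<exists>s. int l dvd s\<^sup>2 - (- int n)"
      proof (cases "l = 2")
        case True
        then show ?thesis using oddn by (intro exI[of _ 1]) simp
      next
        case False
        then have lq: "l dvd q" using l prime_dvd_mult_iff[OF l(1)] primes_dvd_imp_eq[OF l(1) two_is_prime_nat] by blast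
        then have "coprime l M" using coprime_divisors[OF lq dvd_refl q(2)] by simp
        then show ?thesis using res q(3) l(1) lq by blast
      qed
    qed
    moreover have "\<exists>r. int n dvd r\<^sup>2 - (- int (2 * q))"
      using n
    proof (rule square_root_mod_squarefree)
      fix p assume p: "prime p" "p dvd n"
      have "p \<noteq> 2" using p(2) oddn by auto
      then have pP: "p \<in> P" using p by (simp add: P_def odd_primes_of_def)
      note p' = odd_primes_ofD[OF pP[unfolded P_def]]
      have "Legendre (- int (2 * q)) (int p) = Legendre (-2) (int p) * Legendre (-2) (int p)"
        using Legendre_mult[OF p'(1,2), of "-2" "int q"] qP[OF pP] by simp
      also have "\<dots> = 1" using L2[OF pP] by auto
      finally show "\<exists>r. int p dvd r\<^sup>2 - (- int (2 * q))" by (rule Legendre_eq_1_imp_square)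
    qed
    moreover have "coprime n (2 * q)" using q(2) oddn by (simp add: M_def coprime_commute)
    ultimately show thesis using that[of "2 * q"] sf by simp
  qed
qed

section \<open>Sums of three squares\<close>

text \<open>The pigeonhole principle on a box of integer points; the difference of two colliding
  points is the short nonzero vector that Minkowski's theorem would otherwise supply.\<close>

lemma exists_int_coords_small:
  fixes f :: "int \<Rightarrow> int \<Rightarrow> int \<Rightarrow> 'a"
  assumes img: "\<And>x y z. f x y z \<in> B" and B: "finite B" "card B < (a + 1) * (b + 1) * (c + 1)"
  obtains x y z x' y' z' where "f x y z = f x' y' z'" "(x, y, z) \<noteq> (x', y', z')"
    "\<bar>x - x'\<bar> \<le> int a" "\<bar>y - y'\<bar> \<le> int b" "\<bar>z - z'\<bar> \<le> int c"
proof -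
  let ?A = "{0..int a} \<times> {0..int b} \<times> {0..int c}"
  let ?g = "\<lambda>(x, y, z). f x y z"
  have "?g ` ?A \<subseteq> B" using img by auto
  then have "card (?g ` ?A) \<le> card B" using B(1) by (rule card_mono[rotated])
  also have "\<dots> < (a + 1) * (b + 1) * (c + 1)" by (rule B(2))
  also have "\<dots> = card ?A" by (simp add: card_cartesian_product nat_add_distrib algebra_simps)
  finally have "\<not> inj_on ?g ?A" by (rule pigeonhole)
  then obtain u v where uv: "u \<in> ?A" "v \<in> ?A" "?g u = ?g v" "u \<noteq> v" unfolding inj_on_def by blast
  obtain x y z x' y' z' where "u = (x, y, z)" "v = (x', y', z')" by (metis prod_cases3)
  then show thesis using uv by (intro that[of x y z x' y' z']) auto
qed

lemma floor_sqrt_bounds: "(floor_sqrt n)\<^sup>2 \<le> n" "n < (floor_sqrt n + 1)\<^sup>2"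
  using Suc_floor_sqrt_power2_gt[of n] by simp_all

lemma int_abs_le_sqrt: "\<bar>x\<bar> \<le> int (floor_sqrt n) \<Longrightarrow> x\<^sup>2 \<le> int n"
proof -
  assume "\<bar>x\<bar> \<le> int (floor_sqrt n)"
  then have "x\<^sup>2 \<le> (int (floor_sqrt n))\<^sup>2" by (metis abs_le_square_iff abs_of_nat)
  also have "\<dots> \<le> int n" using floor_sqrt_bounds(1)[of n] by (metis of_nat_le_iff of_nat_power)
  finally show ?thesis .
qed

lemma squarefree_eq_square_imp:
  assumes "squarefree (n::nat)" "int n = x\<^sup>2"
  shows "n = 1"
proof -
  have "n = (nat \<bar>x\<bar>)\<^sup>2" using assms(2) by (metis nat_int nat_power_eq abs_ge_zero power2_abs)
  then show ?thesis using squarefreeD[OF assms(1), of "nat \<bar>x\<bar>"] by simp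
qed

text \<open>Thue's argument: a short solution of the congruence of \<open>X\<close> and
  \<open>s * Y\<close> modulo \<open>v\<close> gives \<open>X^2 + c * Y^2 = v * w\<close> with
  \<open>0 < w < 1 + c\<close>. If \<open>c = w = 2\<close>, then \<open>X\<close> is even and
  halving the equation exchanges the two squares.\<close>

lemma squarefree_represented:
  fixes v c :: nat
  assumes v: "squarefree v" and c: "c = 1 \<or> c = 2" and s: "int v dvd s\<^sup>2 + int c"
  shows "\<exists>x y. int v = x\<^sup>2 + int c * y\<^sup>2"
proof (cases "v = 1")
  case True
  then show ?thesis by (intro exI[of _ 1] exI[of _ 0]) simp
next
  case v1: False
  have v0: "v > 0" using v by (auto intro: gr0I)
  let ?k = "floor_sqrt v"
  have card: "card {0..<int v} < (?k + 1) * (?k + 1) * (0 + 1)"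
    using floor_sqrt_bounds(2)[of v] by (simp add: power2_eq_square)
  obtain x y z x' y' z' where *: "(x - s * y) mod int v = (x' - s * y') mod int v"
    "(x, y, z) \<noteq> (x', y', z')" "\<bar>x - x'\<bar> \<le> int ?k" "\<bar>y - y'\<bar> \<le> int ?k" "\<bar>z - z'\<bar> \<le> int 0"
    by (rule exists_int_coords_small[of "\<lambda>x y z. (x - s * y) mod int v" "{0..<int v}" ?k ?k 0])
      (use v0 card in auto)
  define X Y where "X = x - x'" and "Y = y - y'"
  have ne: "X \<noteq> 0 \<or> Y \<noteq> 0" using * by (auto simp: X_def Y_def)
  have dv: "int v dvd X - s * Y"
    using *(1) unfolding X_def Y_def mod_eq_dvd_iff by (simp add: algebra_simps)
  have le: "X\<^sup>2 \<le> int v" "Y\<^sup>2 \<le> int v"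
    using int_abs_le_sqrt * by (auto simp: X_def Y_def)
  then have lt: "X\<^sup>2 < int v" "Y\<^sup>2 < int v"
    using squarefree_eq_square_imp[OF v] v1 by (metis le_less)+
  have "X\<^sup>2 + int c * Y\<^sup>2 = (X - s * Y) * (X + s * Y) + (s\<^sup>2 + int c) * Y\<^sup>2"
    by (simp add: algebra_simps power2_eq_square)
  then have "int v dvd X\<^sup>2 + int c * Y\<^sup>2" using dv s by simp
  then obtain w where w: "X\<^sup>2 + int c * Y\<^sup>2 = int v * w" by blast
  have "X\<^sup>2 + int c * Y\<^sup>2 > 0" using ne c by (auto intro: add_pos_nonneg add_nonneg_pos)
  then have w0: "w > 0" using w v0 by (simp add: zero_less_mult_iff)
  have "int v * w < int v * (1 + int c)" using lt c unfolding w[symmetric] by auto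
  then have w1: "w < 1 + int c" using v0 by simp
  show ?thesis
  proof (cases "w = 1")
    case True
    then show ?thesis using w by (metis mult.right_neutral)
  next
    case False
    then have c2: "c = 2" "w = 2" using w0 w1 c by auto
    then have eq: "X\<^sup>2 + 2 * Y\<^sup>2 = 2 * int v" using w by simp
    then have "X\<^sup>2 = 2 * (int v - Y\<^sup>2)" by simp
    then have "even (X\<^sup>2)" by simp
    then obtain X' where "X = 2 * X'" by auto
    then have "int v = Y\<^sup>2 + 2 * X'\<^sup>2" using eq by (simp add: power_mult_distrib)
    then show ?thesis using c2 by auto
  qed
qed

text \<open>The squarefree part is made of the primes of odd multiplicity; the square part merely
  scales \<open>x\<close> and \<open>y\<close>.\<close>

lemma represented_of_odd_multiplicities:
  fixes v c :: nat
  assumes c: "c = 1 \<or> c = 2"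
    and odd: "\<And>p. prime p \<Longrightarrow> odd (multiplicity p v) \<Longrightarrow> \<exists>s. int p dvd s\<^sup>2 + int c"
  shows "\<exists>x y. int v = x\<^sup>2 + int c * y\<^sup>2"
proof -
  define u k where "u = squarefree_part v" and "k = square_part v"
  have sf: "squarefree u" unfolding u_def by blast
  have vk: "v = u * k\<^sup>2" unfolding u_def k_def by (rule squarefree_decompose)
  have "\<exists>s. int u dvd s\<^sup>2 - (- int c)"
    using sf
  proof (rule square_root_mod_squarefree)
    fix p assume p: "prime p" "p dvd u"
    have "odd (multiplicity p v)"
      using prime_multiplicity_squarefree_part[OF p(1), of v] p sf unfolding u_def
      by (metis mod2_eq_if multiplicity_eq_zero_iff not_prime_unit not_squarefree_0)
    then show "\<exists>s. int p dvd s\<^sup>2 - (- int c)" using odd[OF p(1)] by simp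
  qed
  then obtain s where "int u dvd s\<^sup>2 + int c" by auto
  then obtain x y where "int u = x\<^sup>2 + int c * y\<^sup>2" using squarefree_represented[OF sf c] by blast
  then have "int v = (x * int k)\<^sup>2 + int c * (y * int k)\<^sup>2"
    unfolding vk by (simp add: algebra_simps power_mult_distrib)
  then show ?thesis by blast
qed

text \<open>Multiplication by the square of an inverse of \<open>k\<close> modulo
  \<open>p\<close>.\<close>

lemma prime_dvd_cancel_square:
  assumes p: "prime p" "\<not> int p dvd k" "int p dvd a\<^sup>2 + k\<^sup>2 * w"
  shows "\<exists>t. int p dvd t\<^sup>2 + w"
proof -
  have "prime (int p)" using p(1) by simp
  then have "coprime k (int p)" using p(2) by (metis prime_imp_coprime coprime_commute)
  then obtain z where "[k * z = 1] (mod int p)" using cong_solve_coprime_int by blast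
  then have z: "int p dvd (k * z)\<^sup>2 - 1"
    using cong_pow[of "k * z" 1 "int p" 2] by (simp add: cong_iff_dvd_diff)
  have "(a * z)\<^sup>2 + w = z\<^sup>2 * (a\<^sup>2 + k\<^sup>2 * w) - ((k * z)\<^sup>2 - 1) * w"
    by (simp add: algebra_simps power_mult_distrib)
  then show ?thesis using z p(3) by (intro exI[of _ "a * z"]) simp
qed

text \<open>If \<open>p\<close> does not divide \<open>y\<close>, then \<open>y\<close> can be
  inverted. Otherwise \<open>p\<close> divides \<open>x\<close> too, and dividing by
  \<open>p^2\<close> lowers the multiplicity by 2.\<close>

lemma odd_multiplicity_imp_residue:
  fixes N :: nat
  assumes p: "prime p" and "int N = x\<^sup>2 + int n * y\<^sup>2" "odd (multiplicity p N)"
  shows "\<exists>t. int p dvd t\<^sup>2 + int n"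
  using assms(2,3)
proof (induction N arbitrary: x y rule: less_induct)
  case (less N)
  have N0: "N \<noteq> 0" using less.prems(2) by (auto intro: ccontr)
  have "p dvd N" using less.prems(2) by (metis even_zero not_dvd_imp_multiplicity_0)
  then have pN: "int p dvd x\<^sup>2 + int n * y\<^sup>2" using less.prems(1) by (metis int_dvd_int_iff)
  show ?case
  proof (cases "int p dvd y")
    case False
    then show ?thesis using pN prime_dvd_cancel_square[OF p False, of x "int n"] by (simp add: mult.commute)
  next
    case True
    then have "int p dvd x\<^sup>2" using pN by (simp add: dvd_add_left_iff power2_eq_square)
    moreover have "prime (int p)" using p by simp
    ultimately have "int p dvd x" using prime_dvd_power by blast
    then obtain x' y' where xy: "x = int p * x'" "y = int p * y'" using True by (auto elim!: dvdE)
    define N' where "N' = nat (x'\<^sup>2 + int n * y'\<^sup>2)"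
    have N': "int N' = x'\<^sup>2 + int n * y'\<^sup>2" unfolding N'_def by simp
    have "int N = int (p\<^sup>2 * N')" unfolding less.prems(1) xy using N' by (simp add: algebra_simps power_mult_distrib)
    then have NN: "N = p\<^sup>2 * N'" by (simp only: of_nat_eq_iff)
    then have N'0: "N' \<noteq> 0" using N0 by auto
    have "1 < p\<^sup>2" using prime_gt_1_nat[OF p] by (rule one_less_power) simp
    then have "N' < N" using NN N'0 by simp
    have "multiplicity p N = 2 + multiplicity p N'"
      unfolding NN using p N'0 by (subst prime_elem_multiplicity_mult_distrib) (auto simp: multiplicity_prime_power)
    then show ?thesis using less.IH[OF \<open>N' < N\<close> N'] less.prems(2) by simp
  qed
qed

text \<open>The pigeonhole principle yields \<open>X\<^sup>2 + n Y\<^sup>2 + Q R\<^sup>2 = w n Q\<close> with \<open>w\<close> equal to 1 or 2. For every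
  prime dividing \<open>w n - R\<^sup>2\<close> to an odd power, \<open>-w\<close> is a quadratic residue, so that
  \<open>w n - R\<^sup>2 = e\<^sup>2 + w f\<^sup>2\<close>.\<close>

lemma three_squares_of_mutual_residue:
  fixes n Q :: nat
  assumes n: "squarefree n" "n > 1" and Q: "squarefree Q" and cop: "coprime n Q"
    and s: "int Q dvd s\<^sup>2 + int n" and r: "int n dvd r\<^sup>2 + int Q"
  shows "\<exists>x y z. int n = x\<^sup>2 + y\<^sup>2 + z\<^sup>2"
proof -
  have Q0: "Q > 0" using Q by (auto intro: gr0I)
  \<comment> \<open>These sides bound each of \<open>X^2\<close>, \<open>n * Y^2\<close> and
    \<open>Q * R^2\<close> by \<open>n * Q\<close>, and the box still has more points than there are
    pairs of residues.\<close>
  let ?a = "floor_sqrt (n * Q)" and ?b = "floor_sqrt Q" and ?c = "floor_sqrt n"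
  have card: "card ({0..<int n} \<times> {0..<int Q}) < (?a + 1) * (?b + 1) * (?c + 1)"
  proof -
    have "(n * Q)\<^sup>2 = (n * Q) * (Q * n)" by (simp add: power2_eq_square)
    also have "\<dots> < (?a + 1)\<^sup>2 * ((?b + 1)\<^sup>2 * (?c + 1)\<^sup>2)"
      using n(2) Q0 by (intro mult_strict_mono floor_sqrt_bounds) auto
    also have "\<dots> = ((?a + 1) * (?b + 1) * (?c + 1))\<^sup>2" by (simp only: power_mult_distrib mult.assoc)
    finally have "n * Q < (?a + 1) * (?b + 1) * (?c + 1)" by (rule power_less_imp_less_base) simp
    then show ?thesis by (simp add: card_cartesian_product)
  qed
  let ?f = "\<lambda>x y z. ((x - r * z) mod int n, (x - s * y) mod int Q)"
  obtain x y z x' y' z' where *: "?f x y z = ?f x' y' z'" "(x, y, z) \<noteq> (x', y', z')"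
    "\<bar>x - x'\<bar> \<le> int ?a" "\<bar>y - y'\<bar> \<le> int ?b" "\<bar>z - z'\<bar> \<le> int ?c"
    by (rule exists_int_coords_small[of ?f "{0..<int n} \<times> {0..<int Q}" ?a ?b ?c]) (use card n(2) Q0 in auto)
  define X Y R where "X = x - x'" and "Y = y - y'" and "R = z - z'"
  have ne: "X \<noteq> 0 \<or> Y \<noteq> 0 \<or> R \<noteq> 0" using *(2) by (auto simp: X_def Y_def R_def)
  have le: "X\<^sup>2 \<le> int (n * Q)" "Y\<^sup>2 \<le> int Q" "R\<^sup>2 \<le> int n"
    unfolding X_def Y_def R_def using * by (blast intro: int_abs_le_sqrt)+
  then have Rlt: "R\<^sup>2 < int n" using squarefree_eq_square_imp[OF n(1)] n(2) by (metis le_less less_irrefl)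
  \<comment> \<open>Together with the conditions on \<open>r\<close> and \<open>s\<close>, these two
    congruences make the form \<open>V\<close> divisible by \<open>n\<close> and by
    \<open>Q\<close>.\<close>
  have dn: "int n dvd X - r * R" and dQ: "int Q dvd X - s * Y"
    using *(1) unfolding X_def Y_def R_def by (simp_all add: mod_eq_dvd_iff algebra_simps)
  define V where "V = X\<^sup>2 + int n * Y\<^sup>2 + int Q * R\<^sup>2"
  have "V = (X - r * R) * (X + r * R) + (r\<^sup>2 + int Q) * R\<^sup>2 + int n * Y\<^sup>2"
    by (simp add: V_def algebra_simps power2_eq_square)
  then have "int n dvd V" using dn r by simp
  moreover have "V = (X - s * Y) * (X + s * Y) + (s\<^sup>2 + int n) * Y\<^sup>2 + int Q * R\<^sup>2"
    by (simp add: V_def algebra_simps power2_eq_square)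
  then have "int Q dvd V" using dQ s by simp
  ultimately have "int n * int Q dvd V" using cop by (intro divides_mult) auto
  then obtain w where w: "V = int n * int Q * w" by blast
  have "V > 0"
  proof -
    have "X\<^sup>2 \<ge> 0" "int n * Y\<^sup>2 \<ge> 0" "int Q * R\<^sup>2 \<ge> 0" by simp_all
    moreover have "X\<^sup>2 > 0 \<or> int n * Y\<^sup>2 > 0 \<or> int Q * R\<^sup>2 > 0" using ne n(2) Q0 by auto
    ultimately show ?thesis unfolding V_def by linarith
  qed
  then have w0: "w > 0" using w n(2) Q0 zero_less_mult_pos[of "int n * int Q" w] by simp
  have "int n * Y\<^sup>2 \<le> int n * int Q" using le(2) by (intro mult_left_mono) auto
  moreover have "int Q * R\<^sup>2 < int Q * int n" using Rlt Q0 by (intro mult_strict_left_mono) auto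
  ultimately have "V < int n * int Q * 3" using le(1) unfolding V_def by (simp add: mult.commute)
  then have "w < 3" unfolding w using n(2) Q0 by simp
  then have w12: "w = 1 \<or> w = 2" using w0 by linarith
  define v where "v = nat (w * int n - R\<^sup>2)"
  have v: "int v = w * int n - R\<^sup>2"
  proof -
    have "R\<^sup>2 \<le> w * int n" using Rlt w12 by auto
    then show ?thesis by (simp add: v_def)
  qed
  have Qv: "int (Q * v) = X\<^sup>2 + int n * Y\<^sup>2"
    using w unfolding V_def by (simp add: v algebra_simps)
  \<comment> \<open>For odd \<open>p\<close> not dividing \<open>n\<close>, both \<open>-n\<close>
    and \<open>w * n\<close> are squares modulo \<open>p\<close>, hence so is \<open>-w\<close>. For
    odd \<open>p\<close> dividing \<open>n\<close>, also \<open>X\<close> and \<open>R\<close> are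
    multiples of \<open>p\<close>; dividing the equation by \<open>p\<close> shows that
    \<open>Q * w\<close> is a square modulo \<open>p\<close>, and \<open>-Q\<close> is one because
    of \<open>r\<close>.\<close>
  have res: "\<exists>t. int p dvd t\<^sup>2 + w" if p: "prime p" "odd (multiplicity p v)" for p
  proof (cases "p = 2")
    case True
    then show ?thesis using w12 by (intro exI[of _ "w"]) auto
  next
    case False
    have pint: "prime (int p)" using p(1) by simp
    have pw: "\<not> int p dvd w"
    proof
      assume "int p dvd w"
      then have "p dvd 2" using w12 by (metis dvd_trans int_dvd_int_iff of_nat_1 of_nat_numeral one_dvd)
      then show False using False p(1) primes_dvd_imp_eq two_is_prime_nat by blast
    qed
    have "p dvd v" using p(2) by (metis even_zero not_dvd_imp_multiplicity_0)
    then have pv: "int p dvd w * int n - R\<^sup>2" using v by (metis int_dvd_int_iff)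
    have v0: "v > 0" using p(2) by (auto intro: gr0I)
    show ?thesis
    proof (cases "p dvd n")
      case ndvd: False
      have "\<exists>t. int p dvd t\<^sup>2 + int n"
      proof (cases "p dvd Q")
        case True
        then have "int p dvd s\<^sup>2 + int n" using s by (meson dvd_trans int_dvd_int_iff)
        then show ?thesis by blast
      next
        case False
        then have "multiplicity p (Q * v) = multiplicity p v"
          using p(1) Q0 v0 by (subst prime_elem_multiplicity_mult_distrib) (auto simp: not_dvd_imp_multiplicity_0)
        then show ?thesis using odd_multiplicity_imp_residue[OF p(1) Qv] p(2) by simp
      qed
      then obtain t where t: "int p dvd t\<^sup>2 + int n" by blast
      have "(t * R)\<^sup>2 + (int n)\<^sup>2 * w = (t\<^sup>2 + int n) * R\<^sup>2 + int n * (w * int n - R\<^sup>2)"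
        by (simp add: algebra_simps power2_eq_square)
      then have "int p dvd (t * R)\<^sup>2 + (int n)\<^sup>2 * w" using t pv by simp
      moreover have "\<not> int p dvd int n" using ndvd by simp
      ultimately show ?thesis using prime_dvd_cancel_square[OF p(1)] by blast
    next
      case True
      then obtain m where m: "n = p * m" by blast
      have pQ: "\<not> int p dvd int Q"
        using True cop p(1) by (metis coprime_common_divisor int_dvd_int_iff not_prime_unit)
      have pm: "\<not> int p dvd int m"
      proof
        assume "int p dvd int m"
        then have "p\<^sup>2 dvd n" unfolding m power2_eq_square by simp
        then show False using squarefreeD[OF n(1)] p(1) not_prime_unit by blast
      qed
      have "int p dvd R\<^sup>2" using pv True by (simp add: dvd_diff_right_iff)
      then obtain R' where R': "R = int p * R'" using prime_dvd_power[OF pint] by blast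
      have "int p dvd int (Q * v)" using \<open>p dvd v\<close> by simp
      then have "int p dvd X\<^sup>2" unfolding Qv m by (simp add: dvd_add_left_iff)
      then obtain X' where X': "X = int p * X'" using prime_dvd_power[OF pint] by blast
      have "int p * (int Q * (w * int m - int p * R'\<^sup>2)) = int p * (int p * X'\<^sup>2 + int m * Y\<^sup>2)"
        using Qv unfolding of_nat_mult v unfolding X' R' m by (simp add: algebra_simps power2_eq_square)
      then have "int Q * (w * int m - int p * R'\<^sup>2) = int p * X'\<^sup>2 + int m * Y\<^sup>2"
        using p(1) by (simp only: mult_cancel_left) (auto dest: prime_gt_0_nat)
      then have "int m * (Q * w - Y\<^sup>2) = int p * (X'\<^sup>2 + int Q * R'\<^sup>2)"
        by (simp add: algebra_simps)
      then have "int p dvd int m * (Q * w - Y\<^sup>2)" by simp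
      then have d: "int p dvd Q * w - Y\<^sup>2" using pm prime_dvd_mult_iff[OF pint] by blast
      have rp: "int p dvd r\<^sup>2 + int Q" using r True by (meson dvd_trans int_dvd_int_iff)
      have "(Y * r)\<^sup>2 + (int Q)\<^sup>2 * w = (r\<^sup>2 + int Q) * Y\<^sup>2 + int Q * (Q * w - Y\<^sup>2)"
        by (simp add: algebra_simps power2_eq_square)
      then have "int p dvd (Y * r)\<^sup>2 + (int Q)\<^sup>2 * w" using rp d by simp
      then show ?thesis using prime_dvd_cancel_square[OF p(1) pQ] by blast
    qed
  qed
  have "nat w = 1 \<or> nat w = 2" "int (nat w) = w" using w12 by auto
  then obtain e f where ef: "int v = e\<^sup>2 + w * f\<^sup>2"
    using represented_of_odd_multiplicities[of "nat w" v] res by metis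
  show ?thesis
  proof (cases "w = 1")
    case True
    then have "int n = R\<^sup>2 + e\<^sup>2 + f\<^sup>2" using ef v by simp
    then show ?thesis by blast
  next
    case False
    then have eq: "2 * int n = R\<^sup>2 + e\<^sup>2 + 2 * f\<^sup>2" using ef v w12 by simp
    then have "R\<^sup>2 + e\<^sup>2 = 2 * (int n - f\<^sup>2)" by simp
    then have "even (R\<^sup>2 + e\<^sup>2)" by simp
    then have "even (R + e)" by simp
    \<comment> \<open>With \<open>g = (R + e) / 2\<close> one has
      \<open>R^2 + e^2 = 2 * (g^2 + (R - g)^2)\<close>, which removes the factor 2.\<close>
    then obtain g where g: "e = 2 * g - R" by (metis dvdE add_diff_cancel_left')
    have "int n = g\<^sup>2 + (R - g)\<^sup>2 + f\<^sup>2"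
      using eq unfolding g by (simp add: algebra_simps power2_eq_square)
    then show ?thesis by blast
  qed
qed

text \<open>As 4 does not divide \<open>n\<close>, the square part \<open>k\<close> is odd and
  \<open>k^2\<close> is 1 modulo 8. So the squarefree part lies in the same class as
  \<open>n\<close>, and its representation can be scaled by \<open>k\<close>.\<close>

lemma three_squares:
  fixes n :: nat
  assumes "n mod 4 = 1 \<or> n mod 4 = 2 \<or> n mod 8 = 3"
  shows "\<exists>x y z. int n = x\<^sup>2 + y\<^sup>2 + z\<^sup>2"
proof -
  define m k where "m = squarefree_part n" and "k = square_part n"
  have nm: "n = m * k\<^sup>2" unfolding m_def k_def by (rule squarefree_decompose)
  have sf: "squarefree m" unfolding m_def by blast
  have "odd k"
  proof
    assume "even k"
    then obtain j where "k = 2 * j" by blast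
    then have "n = 4 * (m * j\<^sup>2)" using nm by (simp add: power_mult_distrib)
    then have "n mod 4 = 0" by simp
    then show False using assms by presburger
  qed
  have "k\<^sup>2 mod 8 = 1"
  proof -
    define i where "i = k mod 8"
    have "k\<^sup>2 mod 8 = i\<^sup>2 mod 8" unfolding i_def by (simp add: power_mod)
    then show ?thesis using odd_mod_8_cases[OF \<open>odd k\<close>] unfolding i_def[symmetric] by (elim disjE) simp_all
  qed
  then have "n mod 8 = m mod 8" unfolding nm by (metis mod_mult_right_eq mult.right_neutral)
  then have cl: "m mod 4 = 1 \<or> m mod 4 = 2 \<or> m mod 8 = 3" using assms by presburger
  have "\<exists>x y z. int m = x\<^sup>2 + y\<^sup>2 + z\<^sup>2"
  proof (cases "m = 1")
    case True
    then show ?thesis by (intro exI[of _ 1] exI[of _ 0]) simp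
  next
    case False
    have "m \<noteq> 0" using sf by (metis not_squarefree_0)
    then have m1: "m > 1" using False by simp
    show ?thesis
      using exists_mutual_residue[OF sf cl] three_squares_of_mutual_residue[OF sf m1] by metis
  qed
  then obtain x y z where "int m = x\<^sup>2 + y\<^sup>2 + z\<^sup>2" by blast
  then have "int n = (x * int k)\<^sup>2 + (y * int k)\<^sup>2 + (z * int k)\<^sup>2"
    unfolding nm by (simp add: algebra_simps power_mult_distrib)
  then show ?thesis by blast
qed

section \<open>Sums of four polygonal numbers\<close>

lemma sum_of_three_abs_lt:
  fixes X Y Z b :: int
  assumes "3 * (X\<^sup>2 + Y\<^sup>2 + Z\<^sup>2) < (b + 4)\<^sup>2" "b \<ge> 0"
  shows "\<bar>X\<bar> + \<bar>Y\<bar> + \<bar>Z\<bar> < b + 4"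
proof (rule power_less_imp_less_base)
  have "(p + q + r)\<^sup>2 + ((p - q)\<^sup>2 + (q - r)\<^sup>2 + (p - r)\<^sup>2) = 3 * (p\<^sup>2 + q\<^sup>2 + r\<^sup>2)" for p q r :: int
    by (simp add: power2_eq_square algebra_simps)
  then have "(\<bar>X\<bar> + \<bar>Y\<bar> + \<bar>Z\<bar>)\<^sup>2 + ((\<bar>X\<bar> - \<bar>Y\<bar>)\<^sup>2 + (\<bar>Y\<bar> - \<bar>Z\<bar>)\<^sup>2 + (\<bar>X\<bar> - \<bar>Z\<bar>)\<^sup>2) =
      3 * (\<bar>X\<bar>\<^sup>2 + \<bar>Y\<bar>\<^sup>2 + \<bar>Z\<bar>\<^sup>2)"
    .
  moreover have "(\<bar>X\<bar> - \<bar>Y\<bar>)\<^sup>2 + (\<bar>Y\<bar> - \<bar>Z\<bar>)\<^sup>2 + (\<bar>X\<bar> - \<bar>Z\<bar>)\<^sup>2 \<ge> 0" by simp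
  ultimately show "(\<bar>X\<bar> + \<bar>Y\<bar> + \<bar>Z\<bar>)\<^sup>2 < (b + 4)\<^sup>2" using assms(1) unfolding power2_abs by linarith
qed (use assms(2) in simp)

text \<open>The numbers are \<open>(b + X + Y + Z) / 4\<close> and those obtained from it by
  changing two of the signs of \<open>X\<close>, \<open>Y\<close>, \<open>Z\<close>. They are
  integers, and greater than -1 because the absolute values of \<open>X\<close>, \<open>Y\<close>,
  \<open>Z\<close> sum to less than \<open>b + 4\<close>.\<close>

lemma four_naturals_of_three_squares:
  fixes a b X Y Z :: int
  assumes sq: "X\<^sup>2 + Y\<^sup>2 + Z\<^sup>2 + b\<^sup>2 = 4 * a" and div: "4 dvd b + X + Y + Z" "even (Y + Z)" "even (X + Z)" "even (X + Y)"
    and b: "b \<ge> 0" and lt: "3 * a < b\<^sup>2 + 2 * b + 4"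
  shows "\<exists>x1 x2 x3 x4 :: nat. b = int x1 + int x2 + int x3 + int x4 \<and>
      a = (int x1)\<^sup>2 + (int x2)\<^sup>2 + (int x3)\<^sup>2 + (int x4)\<^sup>2"
proof -
  obtain x where x: "b + X + Y + Z = 4 * x" using div(1) by blast
  obtain u where u: "Y + Z = 2 * u" using div(2) by blast
  obtain v where v: "X + Z = 2 * v" using div(3) by blast
  obtain t where t: "X + Y = 2 * t" using div(4) by blast
  note * = x u v t
  have X: "X = v + t - u" "Y = u + t - v" "Z = u + v - t" "b = 4 * x - u - v - t" using * by linarith+
  have "3 * (X\<^sup>2 + Y\<^sup>2 + Z\<^sup>2) < (b + 4)\<^sup>2"
    using sq lt by (simp add: power2_sum)
  then have "\<bar>X\<bar> + \<bar>Y\<bar> + \<bar>Z\<bar> < b + 4" using b by (rule sum_of_three_abs_lt)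
  then have nn: "x \<ge> 0" "x - u \<ge> 0" "x - v \<ge> 0" "x - t \<ge> 0" using * by linarith+
  have "4 * a = 4 * (x\<^sup>2 + (x - u)\<^sup>2 + (x - v)\<^sup>2 + (x - t)\<^sup>2)"
    unfolding sq[symmetric] X by (simp add: power2_eq_square algebra_simps)
  then have "a = x\<^sup>2 + (x - u)\<^sup>2 + (x - v)\<^sup>2 + (x - t)\<^sup>2" by simp
  then show ?thesis using nn X(4)
    by (intro exI[of _ "nat x"] exI[of _ "nat (x - u)"] exI[of _ "nat (x - v)"] exI[of _ "nat (x - t)"]) simp
qed

lemma odd_square_mod_8: "odd (x::int) \<Longrightarrow> x\<^sup>2 mod 8 = 1"
proof -
  assume "odd x"
  define i where "i = x mod 8"
  have "i = 1 \<or> i = 3 \<or> i = 5 \<or> i = 7" unfolding i_def using \<open>odd x\<close> by presburger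
  moreover have "x\<^sup>2 mod 8 = i\<^sup>2 mod 8" unfolding i_def by (simp add: power_mod)
  ultimately show ?thesis by (elim disjE) simp_all
qed

lemma even_square_mod_4: "even (x::int) \<Longrightarrow> x\<^sup>2 mod 4 = 0"
proof -
  assume "even x"
  then obtain y where "x = 2 * y" by blast
  then show ?thesis by (simp add: power_mult_distrib)
qed

lemma odd_square_mod_4: "odd (x::int) \<Longrightarrow> x\<^sup>2 mod 4 = 1"
  using odd_square_mod_8[of x] by presburger

lemma three_squares_int:
  fixes k :: int
  assumes "k \<ge> 0" "k mod 4 = 1 \<or> k mod 4 = 2 \<or> k mod 8 = 3"
  shows "\<exists>x y z. k = x\<^sup>2 + y\<^sup>2 + z\<^sup>2"
proof -
  define n where "n = nat k"
  have k: "k = int n" using assms(1) by (simp add: n_def)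
  have "n mod 4 = nat (k mod 4)" "n mod 8 = nat (k mod 8)"
    unfolding n_def using assms(1) by (simp_all add: nat_mod_distrib)
  then have "n mod 4 = 1 \<or> n mod 4 = 2 \<or> n mod 8 = 3" using assms(2) by auto
  then show ?thesis unfolding k by (rule three_squares)
qed

text \<open>In the odd case \<open>4 * a - b^2\<close> is 3 modulo 8 and a sum of three odd squares.
  In the even case, with \<open>b = 2 * c\<close>, the number \<open>a - c^2\<close> is 1 or 2
  modulo 4, and its three roots are doubled.\<close>

lemma cauchy_lemma:
  fixes a b :: int
  assumes par: "odd a \<and> odd b \<or> a mod 4 = 2 \<and> even b" and b: "b \<ge> 0"
    and le: "b\<^sup>2 \<le> 4 * a" and lt: "3 * a < b\<^sup>2 + 2 * b + 4"
  shows "\<exists>x1 x2 x3 x4 :: nat. b = int x1 + int x2 + int x3 + int x4 \<and>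
      a = (int x1)\<^sup>2 + (int x2)\<^sup>2 + (int x3)\<^sup>2 + (int x4)\<^sup>2"
  using par
proof
  assume ab: "odd a \<and> odd b"
  have "(4 * a - b\<^sup>2) mod 8 = 3" using odd_square_mod_8[of b] ab by presburger
  then obtain X Y Z where xyz: "4 * a - b\<^sup>2 = X\<^sup>2 + Y\<^sup>2 + Z\<^sup>2"
    using three_squares_int[of "4 * a - b\<^sup>2"] le by auto
  have m4: "(X\<^sup>2 + Y\<^sup>2 + Z\<^sup>2) mod 4 = 3"
    unfolding xyz[symmetric] using \<open>(4 * a - b\<^sup>2) mod 8 = 3\<close> by presburger
  have sq: "X\<^sup>2 mod 4 = (if even X then 0 else 1)" for X :: int
    using even_square_mod_4 odd_square_mod_4 by auto
  have "[X\<^sup>2 mod 4 + Y\<^sup>2 mod 4 + Z\<^sup>2 mod 4 = X\<^sup>2 + Y\<^sup>2 + Z\<^sup>2] (mod 4)"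
    by (intro cong_add) (simp_all add: cong_def)
  then have "(X\<^sup>2 mod 4 + Y\<^sup>2 mod 4 + Z\<^sup>2 mod 4) mod 4 = 3" using m4 by (simp only: cong_def)
  then have "odd X \<and> odd Y \<and> odd Z"
    unfolding sq by (cases "even X"; cases "even Y"; cases "even Z") simp_all
  then have odd: "odd X" "odd Y" "odd Z" by blast+
  \<comment> \<open>The sum of four odd numbers is even, and changing the sign of \<open>Z\<close>
    alters it by 2 modulo 4.\<close>
  have "\<exists>Z'. Z'\<^sup>2 = Z\<^sup>2 \<and> odd Z' \<and> 4 dvd b + X + Y + Z'"
  proof (cases "4 dvd b + X + Y + Z")
    case True
    then show ?thesis using odd by blast
  next
    case False
    then have "4 dvd b + X + Y + - Z" using odd ab by presburger
    then show ?thesis using odd by (intro exI[of _ "- Z"]) simp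
  qed
  then obtain Z' where Z': "Z'\<^sup>2 = Z\<^sup>2" "odd Z'" "4 dvd b + X + Y + Z'" by blast
  show ?thesis
    by (rule four_naturals_of_three_squares[of X Y Z']) (use xyz Z' odd b lt in auto)
next
  assume ab: "a mod 4 = 2 \<and> even b"
  then obtain c where c: "b = 2 * c" by blast
  have "(a - c\<^sup>2) mod 4 = 1 \<or> (a - c\<^sup>2) mod 4 = 2"
  proof (cases "even c")
    case True
    then show ?thesis using even_square_mod_4[of c] ab by presburger
  next
    case False
    then show ?thesis using odd_square_mod_4[of c] ab by presburger
  qed
  moreover have "a - c\<^sup>2 \<ge> 0" using le unfolding c by (simp add: power_mult_distrib)
  ultimately obtain X Y Z where xyz: "a - c\<^sup>2 = X\<^sup>2 + Y\<^sup>2 + Z\<^sup>2"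
    using three_squares_int[of "a - c\<^sup>2"] by auto
  have "even a" using ab by presburger
  moreover have "a = c\<^sup>2 + X\<^sup>2 + Y\<^sup>2 + Z\<^sup>2" using xyz by simp
  ultimately have "even (c\<^sup>2 + X\<^sup>2 + Y\<^sup>2 + Z\<^sup>2)" by simp
  then have "even (c + X + Y + Z)" by simp
  then obtain g where "c + X + Y + Z = 2 * g" by blast
  then have "4 dvd b + 2 * X + 2 * Y + 2 * Z" unfolding c by presburger
  then show ?thesis
    by (intro four_naturals_of_three_squares[of "2 * X" "2 * Y" "2 * Z"]) (use xyz b lt c in \<open>auto simp: power_mult_distrib\<close>)
qed

lemma exists_last:
  fixes P :: "nat \<Rightarrow> bool"
  assumes "P 0" "\<not> P j"
  obtains i where "P i" "\<not> P (Suc i)"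
  using assms by (induction j) auto

text \<open>\<open>b\<close> is the largest member of a residue class modulo \<open>2 m\<close> for which \<open>b\<^sup>2 \<le> 4 a\<close> holds;
  the constant 28 is what makes the other inequality hold there.\<close>

lemma exists_cauchy_parameters:
  fixes m N :: int
  assumes m: "m > 0" "4 dvd m" and N: "N \<ge> 28 * m ^ 3"
  obtains a b where "2 * N = m * (a - b) + 2 * b" "odd a \<and> odd b \<or> a mod 4 = 2 \<and> even b" "b \<ge> 0"
    "b\<^sup>2 \<le> 4 * a" "3 * a < b\<^sup>2 + 2 * b + 4"
proof -
  have m4: "m \<ge> 4" using m by (simp add: zdvd_imp_le)
  obtain h where h: "m = 4 * h" using m(2) by blast
  define q r where "q = N div m" and "r = N mod m"
  have Nqr: "N = m * q + r" "0 \<le> r" "r < m" using m(1) by (auto simp: q_def r_def)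
  have start: "\<exists>a b. 2 * N = m * (a - b) + 2 * b \<and> (odd a \<and> odd b \<or> a mod 4 = 2 \<and> even b) \<and> 0 \<le> b \<and> b < 2 * m"
  proof (cases "odd r \<or> (r + 2 * q) mod 4 = 2")
    case True
    have "odd (r + 2 * q) \<and> odd r \<or> (r + 2 * q) mod 4 = 2 \<and> even r" using True by presburger
    moreover have "2 * N = m * ((r + 2 * q) - r) + 2 * r" using Nqr(1) by (simp add: algebra_simps)
    ultimately show ?thesis using Nqr by (intro exI[of _ "r + 2 * q"] exI[of _ r]) auto
  next
    case False
    \<comment> \<open>Raising \<open>b\<close> from \<open>r\<close> by \<open>m\<close> forces
      \<open>a\<close> to grow by \<open>m - 2\<close>. As \<open>4 dvd m\<close>, this takes
      \<open>a\<close> from 0 to 2 modulo 4.\<close>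
    define a where "a = r + m + 2 * (q - 1)"
    have "a mod 4 = 2 \<and> even (r + m)" using False unfolding h a_def by presburger
    moreover have "2 * N = m * (a - (r + m)) + 2 * (r + m)" unfolding a_def using Nqr(1) by (simp add: algebra_simps)
    ultimately show ?thesis using Nqr by (intro exI[of _ a] exI[of _ "r + m"]) auto
  qed
  then obtain a0 b0 where 0: "2 * N = m * (a0 - b0) + 2 * b0" "odd a0 \<and> odd b0 \<or> a0 mod 4 = 2 \<and> even b0"
    "0 \<le> b0" "b0 < 2 * m" by blast
  \<comment> \<open>These simultaneous increments preserve the equation and, since
    \<open>4 dvd m\<close>, the residue of \<open>a\<close> modulo 4 and the parity of
    \<open>b\<close>.\<close>
  define a b where "a j = a0 + int j * (2 * m - 4)" and "b j = b0 + int j * (2 * m)" for j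
  have eq: "2 * N = m * (a j - b j) + 2 * b j" for j
    using 0(1) by (simp add: a_def b_def algebra_simps)
  have par: "odd (a j) \<and> odd (b j) \<or> a j mod 4 = 2 \<and> even (b j)" for j
  proof -
    have "a j = a0 + 4 * (int j * (2 * h - 1))" "b j = b0 + 2 * (int j * m)"
      by (simp_all add: a_def b_def h algebra_simps)
    moreover have "(a0 + 4 * k) mod 4 = a0 mod 4" "even (a0 + 4 * k) \<longleftrightarrow> even a0" "even (b0 + 2 * k) \<longleftrightarrow> even b0" for k
      by presburger+
    ultimately show ?thesis using 0(2) by simp
  qed
  have bnn: "b j \<ge> 0" for j using 0(3) m4 by (simp add: b_def)
  have ma: "m * a j = (m - 2) * b j + 2 * N" for j using eq[of j] by (simp add: algebra_simps)
  have N0: "N > 0"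
  proof -
    have "m ^ 3 > 0" using m(1) by simp
    then show ?thesis using N by linarith
  qed
  have ma_ge: "m * a j \<ge> 2 * N" for j
    unfolding ma using bnn[of j] m4 by simp
  have P0: "(b 0)\<^sup>2 \<le> 4 * a 0"
  proof -
    have "(b 0)\<^sup>2 \<le> (2 * m)\<^sup>2" by (rule power_mono) (use 0(3,4) in \<open>simp_all add: b_def\<close>)
    then have "m * (b 0)\<^sup>2 \<le> m * (2 * m)\<^sup>2" using m(1) by (intro mult_left_mono) auto
    also have "\<dots> = 4 * m ^ 3" by (simp add: power2_eq_square power3_eq_cube)
    also have "\<dots> \<le> N" using N m(1) by (smt (verit) zero_less_power)
    also have "\<dots> \<le> m * (4 * a 0)" using ma_ge[of 0] N0 by simp
    finally show ?thesis using m(1) by simp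
  qed
  have a0: "a0 \<ge> 0" using order_trans[OF zero_le_power2 P0] by (simp add: a_def)
  \<comment> \<open>An explicit index at which the quadratic growth of \<open>b^2\<close> has
    overtaken the linear growth of \<open>4 * a\<close>.\<close>
  define J where "J = nat (a0 + 2)"
  have PJ: "\<not> (b J)\<^sup>2 \<le> 4 * a J"
  proof -
    define x where "x = int J"
    have x: "x = a0 + 2" unfolding x_def J_def using a0 by simp
    have "b J \<ge> x * (2 * m)" using 0(3) by (simp add: b_def x_def)
    then have "(b J)\<^sup>2 \<ge> (x * (2 * m))\<^sup>2" using x a0 m(1) by (intro power_mono) auto
    moreover have "4 * a J = 4 * (x - 2) + 4 * x * (2 * m - 4)" using x by (simp add: a_def x_def)
    moreover have "(x * (2 * m))\<^sup>2 > 4 * (x - 2) + 4 * x * (2 * m - 4)"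
    proof -
      have "x * m \<ge> 2 * 4" using x a0 m4 by (intro mult_mono) auto
      then have "(x * m) * (x * m) \<ge> 2 * (x * m)" using x a0 m4 by (intro mult_right_mono) auto
      then show ?thesis using x a0 by (simp add: power2_eq_square algebra_simps)
    qed
    ultimately show ?thesis by linarith
  qed
  obtain i where i: "(b i)\<^sup>2 \<le> 4 * a i" "\<not> (b (Suc i))\<^sup>2 \<le> 4 * a (Suc i)"
    by (rule exists_last[where P = "\<lambda>j. (b j)\<^sup>2 \<le> 4 * a j", OF P0 PJ])
  have bS: "b (Suc i) = b i + 2 * m" and aS: "a (Suc i) = a i + 2 * m - 4"
    by (simp_all add: a_def b_def algebra_simps)
  have "m * (224 * m\<^sup>2) \<le> 8 * N" using N by (simp add: power2_eq_square power3_eq_cube)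
  also have "\<dots> \<le> m * (4 * a (Suc i))" using ma_ge[of "Suc i"] by simp
  also have "\<dots> < m * (b (Suc i))\<^sup>2" using i(2) m(1) by simp
  finally have big: "224 * m\<^sup>2 < (b (Suc i))\<^sup>2" using m(1) by simp
  \<comment> \<open>374/25 lies just below the square root of \<open>224 = 8 * 28\<close>. Going
    back one step of \<open>2 * m\<close> leaves \<open>b i > 12.96 * m\<close>, beyond the larger
    root \<open>(6 + sqrt 48) * m\<close> of the quadratic in \<open>key\<close>, to whose
    positivity the last inequality reduces.\<close>
  have b25: "374 * m < 25 * b (Suc i)"
  proof (rule power_less_imp_less_base)
    have "(374 * m)\<^sup>2 \<le> 625 * (224 * m\<^sup>2)" by (simp add: power_mult_distrib)
    also have "\<dots> < (25 * b (Suc i))\<^sup>2" using big by (simp add: power_mult_distrib)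
    finally show "(374 * m)\<^sup>2 < (25 * b (Suc i))\<^sup>2" .
  qed (use bnn[of "Suc i"] in simp)
  then have b25': "25 * b i - 324 * m > 0" unfolding bS by simp
  have "625 * ((b i)\<^sup>2 - 12 * m * b i - 12 * m\<^sup>2) = (25 * b i - 324 * m) * (25 * b i + 24 * m) + 276 * m\<^sup>2"
    by (simp add: power2_eq_square algebra_simps)
  also have "\<dots> > 0" using b25' bnn[of i] m(1) by (intro add_pos_pos mult_pos_pos) auto
  finally have key: "(b i)\<^sup>2 - 12 * m * b i - 12 * m\<^sup>2 > 0" by simp
  have "4 * a i < (b i)\<^sup>2 + 4 * m * b i + 4 * m\<^sup>2 - 8 * m + 16"
    using i(2) unfolding bS aS by (simp add: power2_eq_square algebra_simps)
  moreover have "b i \<ge> 0" by (rule bnn)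
  moreover have "m * b i \<ge> 0" using bnn[of i] m(1) by simp
  ultimately have "3 * a i < (b i)\<^sup>2 + 2 * b i + 4" using key m4 by linarith
  then show thesis using that[OF eq par bnn i(1)] by blast
qed

lemma four_polygonal_numbers:
  fixes m N :: int
  assumes "m > 0" "4 dvd m" "N \<ge> 28 * m ^ 3"
  shows "\<exists>x1 x2 x3 x4 :: nat. N = polygonal (m + 2) (int x1) + polygonal (m + 2) (int x2)
      + polygonal (m + 2) (int x3) + polygonal (m + 2) (int x4)"
proof -
  obtain a b where ab: "2 * N = m * (a - b) + 2 * b" "odd a \<and> odd b \<or> a mod 4 = 2 \<and> even b" "b \<ge> 0"
    "b\<^sup>2 \<le> 4 * a" "3 * a < b\<^sup>2 + 2 * b + 4"
    using exists_cauchy_parameters assms by blast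
  obtain x1 x2 x3 x4 :: nat where x: "b = int x1 + int x2 + int x3 + int x4"
      "a = (int x1)\<^sup>2 + (int x2)\<^sup>2 + (int x3)\<^sup>2 + (int x4)\<^sup>2"
    using cauchy_lemma[OF ab(2-5)] by blast
  have p: "2 * polygonal (m + 2) x = m * x\<^sup>2 - (m - 2) * x" for x
    using two_polygonal[of "m + 2" x] by simp
  have "2 * N = 2 * polygonal (m + 2) (int x1) + 2 * polygonal (m + 2) (int x2)
      + 2 * polygonal (m + 2) (int x3) + 2 * polygonal (m + 2) (int x4)"
    unfolding ab(1) p x by (simp add: algebra_simps)
  then have "N = polygonal (m + 2) (int x1) + polygonal (m + 2) (int x2)
      + polygonal (m + 2) (int x3) + polygonal (m + 2) (int x4)" by linarith
  then show ?thesis by blast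
qed

section \<open>Numbers that are not sums of four polygonal numbers\<close>

text \<open>Modulo 4 the sum counts the odd members, so there are none or four; but four odd squares
  add up to 4 modulo 8.\<close>

lemma four_squares_mod_8_eq_0_imp_even:
  fixes a b c d :: int
  assumes "(a\<^sup>2 + b\<^sup>2 + c\<^sup>2 + d\<^sup>2) mod 8 = 0"
  shows "even a \<and> even b \<and> even c \<and> even d"
proof -
  have sq: "x\<^sup>2 mod 8 = 1 \<and> odd x \<or> (x\<^sup>2 mod 8 = 0 \<or> x\<^sup>2 mod 8 = 4) \<and> even x" for x :: int
  proof (cases "even x")
    case True
    have *: "p mod 8 = 0 \<or> p mod 8 = 4" if "p mod 4 = 0" for p :: int using that by presburger
    show ?thesis using *[OF even_square_mod_4[OF True]] True by blast
  qed (use odd_square_mod_8 in blast)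
  have "[a\<^sup>2 mod 8 + b\<^sup>2 mod 8 + c\<^sup>2 mod 8 + d\<^sup>2 mod 8 = a\<^sup>2 + b\<^sup>2 + c\<^sup>2 + d\<^sup>2] (mod 8)"
    by (intro cong_add) (simp_all add: cong_def)
  then have "(a\<^sup>2 mod 8 + b\<^sup>2 mod 8 + c\<^sup>2 mod 8 + d\<^sup>2 mod 8) mod 8 = 0" using assms by (simp only: cong_def)
  then show ?thesis using sq[of a] sq[of b] sq[of c] sq[of d] by (elim disjE conjE) simp_all
qed

text \<open>Halving descends to the sum 2, which is too small for four nonzero squares.\<close>

lemma four_squares_eq_2_mult_4_power:
  fixes a b c d :: int
  assumes "a\<^sup>2 + b\<^sup>2 + c\<^sup>2 + d\<^sup>2 = 2 * 4 ^ n"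
  shows "a = 0 \<or> b = 0 \<or> c = 0 \<or> d = 0"
  using assms
proof (induction n arbitrary: a b c d)
  case 0
  show ?case
  proof (rule ccontr)
    assume "\<not> ?case"
    then have "a\<^sup>2 > 0" "b\<^sup>2 > 0" "c\<^sup>2 > 0" "d\<^sup>2 > 0" by auto
    moreover have "a\<^sup>2 + b\<^sup>2 + c\<^sup>2 + d\<^sup>2 = 2" using 0 by simp
    ultimately show False by linarith
  qed
next
  case (Suc n)
  have "(a\<^sup>2 + b\<^sup>2 + c\<^sup>2 + d\<^sup>2) mod 8 = 0" unfolding Suc.prems by simp
  from four_squares_mod_8_eq_0_imp_even[OF this]
  obtain a' b' c' d' where *: "a = 2 * a'" "b = 2 * b'" "c = 2 * c'" "d = 2 * d'" by (metis dvdE)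
  have "a'\<^sup>2 + b'\<^sup>2 + c'\<^sup>2 + d'\<^sup>2 = 2 * 4 ^ n"
    using Suc.prems unfolding * by (simp add: power_mult_distrib)
  from Suc.IH[OF this] show ?case unfolding * by simp
qed

text \<open>Halving descends to the sum 4, where nonzero squares must all be 1.\<close>

lemma four_squares_eq_4_power:
  fixes a b c d :: int
  assumes "a\<^sup>2 + b\<^sup>2 + c\<^sup>2 + d\<^sup>2 = 4 ^ Suc n" "a \<noteq> 0" "b \<noteq> 0" "c \<noteq> 0" "d \<noteq> 0"
  shows "\<bar>a\<bar> = 2 ^ n"
  using assms
proof (induction n arbitrary: a b c d)
  case 0
  then have "b\<^sup>2 > 0" "c\<^sup>2 > 0" "d\<^sup>2 > 0" by auto
  moreover have "a\<^sup>2 + b\<^sup>2 + c\<^sup>2 + d\<^sup>2 = 4" using 0(1) by simp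
  ultimately have "a\<^sup>2 \<le> 1" by linarith
  then show ?case using 0(2) by (simp add: abs_square_le_1)
next
  case (Suc n)
  have "(a\<^sup>2 + b\<^sup>2 + c\<^sup>2 + d\<^sup>2) mod 8 = 0" unfolding Suc.prems by simp
  from four_squares_mod_8_eq_0_imp_even[OF this]
  obtain a' b' c' d' where *: "a = 2 * a'" "b = 2 * b'" "c = 2 * c'" "d = 2 * d'" by (metis dvdE)
  have "a'\<^sup>2 + b'\<^sup>2 + c'\<^sup>2 + d'\<^sup>2 = 4 ^ Suc n"
    using Suc.prems(1) unfolding * by (simp add: power_mult_distrib)
  moreover have "a' \<noteq> 0" "b' \<noteq> 0" "c' \<noteq> 0" "d' \<noteq> 0" using Suc.prems(2-5) * by auto
  ultimately have "\<bar>a'\<bar> = 2 ^ n" by (rule Suc.IH)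
  then show ?case unfolding * by (simp add: abs_mult)
qed

lemma less_two_power: "int n < 2 ^ n"
  by (metis of_nat_less_iff of_nat_power of_nat_numeral less_exp)

text \<open>If some odd power of 2 is 1 modulo \<open>2 * j + 1\<close>, take \<open>K = 2 * 4 ^ n\<close>; otherwise take \<open>K = 4 ^ n\<close>
  with \<open>2 ^ n\<close> different from 1 modulo \<open>2 * j + 1\<close>, where \<open>2 * n\<close> is an odd multiple of the (even)
  order of 2.\<close>

lemma exists_large_obstruction:
  fixes j B :: int
  assumes j: "j \<ge> 1"
  obtains K where "K > B" "2 * j + 1 dvd K - 1"
    "\<And>x1 x2 x3 x4 :: nat. ((2 * j + 1) * int x1 - j)\<^sup>2 + ((2 * j + 1) * int x2 - j)\<^sup>2
      + ((2 * j + 1) * int x3 - j)\<^sup>2 + ((2 * j + 1) * int x4 - j)\<^sup>2 \<noteq> K"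
proof -
  define M where "M = 2 * j + 1"
  have M: "M > 1" "odd M" using j by (auto simp: M_def)
  \<comment> \<open>As \<open>0 < j < M\<close>, none of the four squares can vanish.\<close>
  have nz: "M * int x - j \<noteq> 0" for x
  proof
    assume "M * int x - j = 0"
    then have "M dvd j" by (metis dvd_triv_left eq_iff_diff_eq_0)
    then have "M \<le> j" using j by (simp add: zdvd_imp_le)
    then show False using j by (simp add: M_def)
  qed
  define G where "G t \<longleftrightarrow> t > 0 \<and> [2 ^ t = 1] (mod M)" for t :: nat
  have G_mult: "G (t * (2 * i + 1))" if "G t" for t i
    using that cong_pow[of "2 ^ t" 1 M "2 * i + 1"]
    by (simp only: G_def power_mult[symmetric] power_one) simp
  show thesis
  proof (cases "\<exists>t. odd t \<and> G t")
    case True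
    then obtain t where t: "odd t" "G t" by blast
    \<comment> \<open>An odd multiple keeps the exponent odd; this one is large enough for
      \<open>2 ^ e > B\<close>.\<close>
    define e where "e = t * (2 * nat \<bar>B\<bar> + 1)"
    have "G e" unfolding e_def using G_mult t(2) by blast
    have "odd e" unfolding e_def using t(1) by simp
    then obtain n where n: "e = 2 * n + 1" by (metis oddE)
    show thesis
    proof (rule that[of "2 ^ e"])
      have "t > 0" using t(2) by (simp add: G_def)
      then have "nat \<bar>B\<bar> \<le> e" unfolding e_def by (cases t) auto
      then have "B \<le> int e" by linarith
      then show "B < 2 ^ e" using less_two_power[of e] by linarith
      show "2 * j + 1 dvd 2 ^ e - 1"
        using \<open>G e\<close> unfolding G_def M_def by (simp add: cong_iff_dvd_diff)
      have "2 ^ e = 2 * (4::int) ^ n" unfolding n by (simp add: power_mult)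
      then show "((2 * j + 1) * int x1 - j)\<^sup>2 + ((2 * j + 1) * int x2 - j)\<^sup>2
        + ((2 * j + 1) * int x3 - j)\<^sup>2 + ((2 * j + 1) * int x4 - j)\<^sup>2 \<noteq> 2 ^ e" for x1 x2 x3 x4
        using four_squares_eq_2_mult_4_power[of _ _ _ _ n] nz unfolding M_def by metis
    qed
  next
    case False
    have "coprime 2 M" using M(2) by (simp add: coprime_commute)
    then have "coprime 2 (nat M)" using M by (metis coprime_int_iff int_nat_eq of_nat_numeral zless_nat_eq_int_zless zero_less_one less_trans less_imp_le)
    then have "[2 ^ totient (nat M) = 1] (mod nat M)" by (rule euler_theorem)
    then have "[int (2 ^ totient (nat M)) = int 1] (mod int (nat M))" by (simp only: cong_int_iff)
    then have "G (totient (nat M))" using M by (simp add: G_def)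
    then have GL: "G (LEAST t. G t)" by (rule LeastI)
    define e where "e = (LEAST t. G t) div 2"
    have "even (LEAST t. G t)" using False GL by blast
    then have e: "2 * e = (LEAST t. G t)" unfolding e_def by simp
    have G2e: "G (2 * e)" unfolding e by (rule GL)
    then have e0: "e > 0" by (simp add: G_def)
    have ne: "\<not> [2 ^ e = 1] (mod M)"
    proof
      assume "[2 ^ e = 1] (mod M)"
      then have "G e" using e0 by (simp add: G_def)
      then have "2 * e \<le> e" unfolding e by (rule Least_le)
      then show False using e0 by simp
    qed
    \<comment> \<open>Makes \<open>n\<close> large enough both for \<open>4 ^ n > B\<close> and for
      \<open>j < 2 ^ (n - 1)\<close>.\<close>
    define i where "i = nat \<bar>B\<bar> + nat j"
    define n where "n = e * (2 * i + 1)"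
    have n_eq: "n = 2 * e * i + e" by (simp add: n_def algebra_simps)
    \<comment> \<open>\<open>2 ^ (2 * e)\<close> is 1 modulo \<open>M\<close>, so
      \<open>2 ^ n\<close> agrees with \<open>2 ^ e\<close>, which by minimality of
      \<open>2 * e\<close> is not 1.\<close>
    have "[(2 ^ (2 * e)) ^ i * 2 ^ e = 1 ^ i * 2 ^ e] (mod M)"
      using G2e unfolding G_def by (intro cong_mult cong_pow) auto
    then have "[2 ^ n = 2 ^ e] (mod M)" by (simp add: n_eq power_add power_mult)
    then have ne_n: "\<not> [2 ^ n = 1] (mod M)" using ne by (metis cong_sym cong_trans)
    have in_le: "i \<le> n - 1" using e0 unfolding n_def by (cases e) auto
    have n0: "n > 0" using e0 by (simp add: n_def)
    then obtain k where k: "n = Suc k" using gr0_implies_Suc by blast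
    have jk: "j < 2 ^ k"
    proof -
      have "j \<le> int k" using in_le k i_def j by simp
      then show ?thesis using less_two_power[of k] by linarith
    qed
    show thesis
    proof (rule that[of "4 ^ n"])
      have "B \<le> int (2 * n)" using in_le i_def by linarith
      moreover have "(4::int) ^ n = 2 ^ (2 * n)" by (simp add: power_mult)
      ultimately show "B < 4 ^ n" using less_two_power[of "2 * n"] by linarith
      have "2 * e * (2 * i + 1) = 2 * n" by (simp add: n_def)
      then have "G (2 * n)" using G_mult[OF G2e, of i] by simp
      moreover have "(2::int) ^ (2 * n) = 4 ^ n" by (simp add: power_mult)
      ultimately show "2 * j + 1 dvd 4 ^ n - 1"
        unfolding G_def M_def by (simp add: cong_iff_dvd_diff)
      show "((2 * j + 1) * int x1 - j)\<^sup>2 + ((2 * j + 1) * int x2 - j)\<^sup>2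
        + ((2 * j + 1) * int x3 - j)\<^sup>2 + ((2 * j + 1) * int x4 - j)\<^sup>2 \<noteq> 4 ^ n" for x1 x2 x3 x4
      proof
        assume "((2 * j + 1) * int x1 - j)\<^sup>2 + ((2 * j + 1) * int x2 - j)\<^sup>2
          + ((2 * j + 1) * int x3 - j)\<^sup>2 + ((2 * j + 1) * int x4 - j)\<^sup>2 = 4 ^ n"
        then have "\<bar>M * int x1 - j\<bar> = 2 ^ k"
          unfolding k M_def[symmetric] by (rule four_squares_eq_4_power) (rule nz)+
        moreover have "M * int x1 \<ge> 0" using M by simp
        \<comment> \<open>The opposite sign would make \<open>M * int x1\<close> negative because
          \<open>j < 2 ^ k\<close>. Doubling this equation and subtracting 1 turns
          \<open>2 * j + 1\<close> into \<open>M\<close>, so that \<open>M\<close> divides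
          \<open>2 ^ n - 1\<close>.\<close>
        ultimately have "M * int x1 - j = 2 ^ k" using jk by linarith
        then have "2 ^ n - 1 = M * (2 * int x1 - 1)" unfolding k M_def by (simp add: algebra_simps)
        then have "[2 ^ n = 1] (mod M)" by (simp add: cong_iff_dvd_diff)
        then show False using ne_n by blast
      qed
    qed
  qed
qed

text \<open>With \<open>m = 4 * j\<close> and \<open>M = 2 * j + 1\<close>, completing the square
  gives \<open>M * polygonal (m + 4) x = (M * x - j)^2 - j^2\<close>. A representation of
  \<open>N\<close> would thus write \<open>M * N + 4 * j^2\<close> as a sum of four of these
  squares, which fails for the obstructions \<open>K\<close>.\<close>

lemma infinite_not_four_polygonal_numbers:
  fixes m :: int
  assumes "m > 0" "4 dvd m"
  shows "infinite {N::int. N > 0 \<and>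
           \<not> (\<exists>x1 x2 x3 x4 :: nat.
              N = polygonal (m + 4) (int x1) + polygonal (m + 4) (int x2)
                + polygonal (m + 4) (int x3) + polygonal (m + 4) (int x4))}" (is "infinite ?S")
  unfolding infinite_int_iff_unbounded
proof
  fix B :: int
  obtain j where mj: "m = 4 * j" using assms(2) by blast
  then have j: "j \<ge> 1" using assms(1) by simp
  define M where "M = 2 * j + 1"
  have M0: "M > 0" using j by (simp add: M_def)
  obtain K where K: "K > M * \<bar>B\<bar> + 4 * j\<^sup>2" "M dvd K - 1"
    "\<And>x1 x2 x3 x4 :: nat. (M * int x1 - j)\<^sup>2 + (M * int x2 - j)\<^sup>2
      + (M * int x3 - j)\<^sup>2 + (M * int x4 - j)\<^sup>2 \<noteq> K"
    using exists_large_obstruction[OF j, of "M * \<bar>B\<bar> + 4 * j\<^sup>2"] unfolding M_def[symmetric] by metis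
  \<comment> \<open>\<open>2 * j\<close> is -1 modulo \<open>M\<close>, so \<open>4 * j^2\<close> is
    1 just like \<open>K\<close>, and the quotient \<open>N\<close> is an integer.\<close>
  have "K - 4 * j\<^sup>2 = (K - 1) - M * (2 * j - 1)" by (simp add: M_def power2_eq_square algebra_simps)
  moreover have "M dvd (K - 1) - M * (2 * j - 1)" using K(2) by simp
  ultimately have "M dvd K - 4 * j\<^sup>2" by (simp only:)
  then obtain N where N: "K - 4 * j\<^sup>2 = M * N" by blast
  have "M * \<bar>B\<bar> < M * N" using K(1) N by linarith
  then have NB: "\<bar>B\<bar> < N" using M0 by simp
  have p: "2 * polygonal (m + 4) x = 2 * M * x\<^sup>2 - 4 * j * x" for x
    using two_polygonal[of "m + 4" x] by (simp add: mj M_def algebra_simps)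
  have "N \<noteq> polygonal (m + 4) (int x1) + polygonal (m + 4) (int x2)
      + polygonal (m + 4) (int x3) + polygonal (m + 4) (int x4)" for x1 x2 x3 x4
  proof
    assume "N = polygonal (m + 4) (int x1) + polygonal (m + 4) (int x2)
      + polygonal (m + 4) (int x3) + polygonal (m + 4) (int x4)"
    then have "2 * N = 2 * polygonal (m + 4) (int x1) + 2 * polygonal (m + 4) (int x2)
      + 2 * polygonal (m + 4) (int x3) + 2 * polygonal (m + 4) (int x4)" by simp
    then have N2: "N = M * (int x1)\<^sup>2 - 2 * j * int x1 + (M * (int x2)\<^sup>2 - 2 * j * int x2)
      + (M * (int x3)\<^sup>2 - 2 * j * int x3) + (M * (int x4)\<^sup>2 - 2 * j * int x4)"
      unfolding p by simp
    have "K = M * N + 4 * j\<^sup>2" using N by simp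
    also have "\<dots> = (M * int x1 - j)\<^sup>2 + (M * int x2 - j)\<^sup>2
      + (M * int x3 - j)\<^sup>2 + (M * int x4 - j)\<^sup>2"
      unfolding N2 by (simp add: power2_eq_square algebra_simps)
    finally show False using K(3) by metis
  qed
  then have "N \<in> ?S" using NB by auto
  then show "\<exists>n. B < \<bar>n\<bar> \<and> n \<in> ?S" using NB by (intro exI[of _ N]) auto
qed

theorem theorem1p1:
  fixes m :: int
  assumes "m > 0" and "4 dvd m"
  shows "(\<forall>N::int. N \<ge> 28 * m ^ 3 \<longrightarrow>
           (\<exists>x1 x2 x3 x4 :: nat.
              N = polygonal (m + 2) (int x1) + polygonal (m + 2) (int x2)
                + polygonal (m + 2) (int x3) + polygonal (m + 2) (int x4)))
       \<and> infinite {N::int. N > 0 \<and>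
           \<not> (\<exists>x1 x2 x3 x4 :: nat.
              N = polygonal (m + 4) (int x1) + polygonal (m + 4) (int x2)
                + polygonal (m + 4) (int x3) + polygonal (m + 4) (int x4))}"
  using four_polygonal_numbers[OF assms] infinite_not_four_polygonal_numbers[OF assms] by blast

end
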